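(* Let $G$ and $H$ be graphs of orders $N_1$ and $N_2$, respectively, each with at least one edge, and let $G\square H$ denote their Cartesian product. Then $$\mathcal E(G\square H)\geq\frac12\bigl(N_2\mathcal E(G)+N_1\mathcal E(H)\bigr).$$ If in addition $N_1$ and $N_2$ are coprime, then $$\kappa(G\square H)\leq2\max\{\kappa(G),\kappa(H)\}.$$
   Context: Graphs are finite, simple and undirected; $s_G$ denotes the number of edges of $G$. The Cartesian product $G\square H$ has vertex set $V(G)\times V(H)$, and $(g_1,h_1)$ is adjacent to $(g_2,h_2)$ if and only if either $g_1=g_2$ and $h_1$ is adjacent to $h_2$, or $h_1=h_2$ and $g_1$ is adjacent to $g_2$. A vertex labeling of a graph $G=(V,E)$ of order $N=|V|$ is a bijection $\sigma:V\to\mathbb Z_N=\mathbb Z/N\mathbb Z$. The adjacency matrix under $\sigma$ is the $N\times N$ matrix $A_\sigma$, indexed by $\mathbb Z_N\times\mathbb Z_N$, with $(A_\sigma)_{x,y}=1$ if the vertices labeled $x$ and $y$ are adjacent and $0$ otherwise. $F$ is the unitary Fourier matrix $F_{mx}=\frac1{\sqrt N}e^{-2\pi i mx/N}$. The Fourier ratio of a nonzero $N\times N$ matrix $M$ is $\operatorname{FR}(M)=\|FMF\|_1/\|FMF\|_2$, where $\|\cdot\|_1$ is the entrywise $\ell^1$-norm and $\|\cdot\|_2$ the Frobenius norm. The edge complexity of a graph with at least one edge is $\operatorname{FR}_{\min}(G)=\min_\sigma\operatorname{FR}(A_\sigma)$, the minimum over all vertex labelings (by $\mathbb Z_N$ with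 $N$ the order of that graph). The graph energy $\mathcal E(G)$ is the sum of the absolute values of the adjacency eigenvalues counted with multiplicity. The energy-gap factor of a graph with $s_G>0$ is $\kappa(G)=\operatorname{FR}_{\min}(G)\big/\bigl(\mathcal E(G)/\sqrt{2s_G}\bigr)$. *)

theory Defs
  imports
    "Graph_Theory.Pair_Digraph"
    "Jordan_Normal_Form.Char_Poly"
    Complex_Main
begin

section \<open>Graphs\<close>

text \<open>
  A finite simple undirected graph is a \<^locale>\<open>pair_graph\<close>: a finite, loop-free digraph without
  parallel arcs whose arc relation is symmetric.  An undirected edge is thus a pair of opposite
  arcs, which is why edges are counted as two-element vertex sets.
\<close>

definition num_edges :: "'a pair_pre_digraph \<Rightarrow> nat" where
  "num_edges G = card ((\<lambda>(u, v). {u, v}) ` parcs G)"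

definition cartesian_product ::
    "'a pair_pre_digraph \<Rightarrow> 'b pair_pre_digraph \<Rightarrow> ('a \<times> 'b) pair_pre_digraph" where
  "cartesian_product G H =
     \<lparr> pverts = pverts G \<times> pverts H,
       parcs = {((g1, h1), (g2, h2)) | g1 h1 g2 h2.
                  (g1 = g2 \<and> g1 \<in> pverts G \<and> (h1, h2) \<in> parcs H) \<or>
                  (h1 = h2 \<and> h1 \<in> pverts H \<and> (g1, g2) \<in> parcs G)} \<rparr>"

lemma pair_graph_cartesian_product:
  assumes "pair_graph G" "pair_graph H"
  shows "pair_graph (cartesian_product G H)"
proof -
  interpret G: pair_graph G by fact
  interpret H: pair_graph H by fact
  let ?P = "cartesian_product G H"
  have sub: "parcs ?P \<subseteq> pverts ?P \<times> pverts ?P"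
    by (auto simp: cartesian_product_def dest: G.in_arcsD1 G.in_arcsD2 H.in_arcsD1 H.in_arcsD2)
  have fin: "finite (pverts ?P)"
    by (auto simp: cartesian_product_def)
  have "finite (parcs ?P)"
    by (rule finite_subset[OF sub]) (use fin in auto)
  moreover have "(v, u) \<in> parcs ?P" if "(u, v) \<in> parcs ?P" for u v
    using that G.pair_sym_arcs H.pair_sym_arcs
    by (auto simp: cartesian_product_def symmetric_conv)
  hence "symmetric (with_proj ?P)"
    by (auto simp: symmetric_def sym_def)
  moreover have "fst e \<noteq> snd e" if "e \<in> parcs ?P" for e
    using that G.pair_no_loops H.pair_no_loops by (fastforce simp: cartesian_product_def)
  ultimately show ?thesis
    using sub fin by unfold_locales auto
qed


section \<open>Vertex labelings and adjacency matrices\<close>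

text \<open>
  Labels in the integers modulo \<open>N\<close> are represented by the residues in \<open>{0..<N}\<close>.
  The values of a labeling outside the vertex set are irrelevant.
\<close>

definition vertex_labeling :: "'a pair_pre_digraph \<Rightarrow> ('a \<Rightarrow> nat) \<Rightarrow> bool" where
  "vertex_labeling G \<sigma> \<longleftrightarrow> bij_betw \<sigma> (pverts G) {0..<card (pverts G)}"

definition adjacency_mat :: "'a pair_pre_digraph \<Rightarrow> ('a \<Rightarrow> nat) \<Rightarrow> complex mat" where
  "adjacency_mat G \<sigma> =
     mat (card (pverts G)) (card (pverts G))
       (\<lambda>(x, y). if (inv_into (pverts G) \<sigma> x, inv_into (pverts G) \<sigma> y) \<in> parcs G then 1 else 0)"

lemma ex_vertex_labeling: "finite (pverts G) \<Longrightarrow> \<exists>\<sigma>. vertex_labeling G \<sigma>"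
  unfolding vertex_labeling_def by (rule ex_bij_betw_finite_nat)


section \<open>Fourier ratio and edge complexity\<close>

definition fourier_mat :: "nat \<Rightarrow> complex mat" where
  "fourier_mat N =
     mat N N (\<lambda>(m, x). 1 / complex_of_real (sqrt (real N)) *
       exp (- 2 * complex_of_real pi * \<i> * of_nat m * of_nat x / of_nat N))"

definition entrywise_l1_norm :: "complex mat \<Rightarrow> real" where
  "entrywise_l1_norm M = (\<Sum>i<dim_row M. \<Sum>j<dim_col M. cmod (M $$ (i, j)))"

definition frobenius_norm :: "complex mat \<Rightarrow> real" where
  "frobenius_norm M = sqrt (\<Sum>i<dim_row M. \<Sum>j<dim_col M. (cmod (M $$ (i, j)))\<^sup>2)"

definition fourier_ratio :: "complex mat \<Rightarrow> real" where
  "fourier_ratio M =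
     (let F = fourier_mat (dim_row M)
      in entrywise_l1_norm (F * M * F) / frobenius_norm (F * M * F))"

definition edge_complexity :: "'a pair_pre_digraph \<Rightarrow> real" where
  "edge_complexity G = Min {fourier_ratio (adjacency_mat G \<sigma>) | \<sigma>. vertex_labeling G \<sigma>}"

text \<open>The minimum is over a finite nonempty set of values.\<close>

lemma finite_fourier_ratios:
  "finite {fourier_ratio (adjacency_mat G \<sigma>) | \<sigma>. vertex_labeling G \<sigma>}"
proof -
  let ?N = "card (pverts G)"
  let ?f = "\<lambda>S. mat ?N ?N (\<lambda>p. if p \<in> S then 1 else 0 :: complex)"
  have "adjacency_mat G \<sigma> \<in> ?f ` Pow ({0..<?N} \<times> {0..<?N})" for \<sigma>
  proof (rule image_eqI)
    let ?S = "{(x, y). x < ?N \<and> y < ?N \<and>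
      (inv_into (pverts G) \<sigma> x, inv_into (pverts G) \<sigma> y) \<in> parcs G}"
    show "adjacency_mat G \<sigma> = ?f ?S"
      by (rule eq_matI) (auto simp: adjacency_mat_def)
    show "?S \<in> Pow ({0..<?N} \<times> {0..<?N})"
      by auto
  qed
  hence "{fourier_ratio (adjacency_mat G \<sigma>) | \<sigma>. vertex_labeling G \<sigma>}
      \<subseteq> fourier_ratio ` ?f ` Pow ({0..<?N} \<times> {0..<?N})"
    by blast
  thus ?thesis
    by (rule finite_subset) auto
qed

lemma fourier_ratios_nonempty:
  "finite (pverts G) \<Longrightarrow> {fourier_ratio (adjacency_mat G \<sigma>) | \<sigma>. vertex_labeling G \<sigma>} \<noteq> {}"
  using ex_vertex_labeling[of G] by blast


section \<open>Graph energy and energy-gap factor\<close>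

definition mat_energy :: "complex mat \<Rightarrow> real" where
  "mat_energy A = (\<Sum>\<mu> | eigenvalue A \<mu>. real (order \<mu> (char_poly A)) * cmod \<mu>)"

text \<open>
  The spectrum of the adjacency matrix does not depend on the labeling, so the energy may be read
  off from any of them; see \<open>energy_eq\<close> below.
\<close>

definition energy :: "'a pair_pre_digraph \<Rightarrow> real" where
  "energy G = mat_energy (adjacency_mat G (SOME \<sigma>. vertex_labeling G \<sigma>))"

definition energy_gap_factor :: "'a pair_pre_digraph \<Rightarrow> real" where
  "energy_gap_factor G = edge_complexity G / (energy G / sqrt (2 * real (num_edges G)))"

lemma similar_adjacency_mat:
  assumes \<sigma>: "vertex_labeling G \<sigma>" and \<tau>: "vertex_labeling G \<tau>"
  shows "similar_mat (adjacency_mat G \<tau>) (adjacency_mat G \<sigma>)"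
proof -
  define N where "N = card (pverts G)"
  define b where "b = (\<lambda>i. \<sigma> (inv_into (pverts G) \<tau> i))"
  define P where "P = mat N N (\<lambda>(i, j). if j = b i then 1 else 0 :: complex)"
  define Q where "Q = mat N N (\<lambda>(i, j). if i = b j then 1 else 0 :: complex)"
  let ?A = "adjacency_mat G \<sigma>" and ?B = "adjacency_mat G \<tau>"
  have bij: "bij_betw \<sigma> (pverts G) {0..<N}" "bij_betw \<tau> (pverts G) {0..<N}"
    using \<sigma> \<tau> by (auto simp: vertex_labeling_def N_def)
  have inv_in: "inv_into (pverts G) \<tau> i \<in> pverts G" if "i < N" for i
    using that bij(2) by (intro inv_into_into) (auto simp: bij_betw_def)
  have b_less: "b i < N" if "i < N" for i
    using inv_in[OF that] bij(1) by (auto simp: b_def bij_betw_def)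
  have inv_b: "inv_into (pverts G) \<sigma> (b i) = inv_into (pverts G) \<tau> i" if "i < N" for i
    using inv_in[OF that] bij(1) by (auto simp: b_def bij_betw_def)
  have b_inj: "b i = b j \<longleftrightarrow> i = j" if "i < N" "j < N" for i j
    using that inv_b[of i] inv_b[of j] bij(2)
    by (metis atLeast0LessThan bij_betw_inv_into_right lessThan_iff)
  have A: "?A \<in> carrier_mat N N" and B: "?B \<in> carrier_mat N N"
    by (auto simp: adjacency_mat_def N_def)
  have P: "P \<in> carrier_mat N N" and Q: "Q \<in> carrier_mat N N"
    by (auto simp: P_def Q_def)
  have PM: "(P * M) $$ (i, k) = M $$ (b i, k)" if "M \<in> carrier_mat N N" "i < N" "k < N" for M i k
  proof -
    have "(P * M) $$ (i, k) = (\<Sum>j<N. P $$ (i, j) * M $$ (j, k))"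
      using that P by (auto simp: scalar_prod_def lessThan_atLeast0)
    also have "\<dots> = (\<Sum>j<N. if j = b i then M $$ (j, k) else 0)"
      using that by (intro sum.cong) (auto simp: P_def)
    also have "\<dots> = M $$ (b i, k)"
      using b_less that by simp
    finally show ?thesis .
  qed
  have MQ: "(M * Q) $$ (i, k) = M $$ (i, b k)" if "M \<in> carrier_mat N N" "i < N" "k < N" for M i k
  proof -
    have "(M * Q) $$ (i, k) = (\<Sum>j<N. M $$ (i, j) * Q $$ (j, k))"
      using that Q by (auto simp: scalar_prod_def lessThan_atLeast0)
    also have "\<dots> = (\<Sum>j<N. if j = b k then M $$ (i, j) else 0)"
      using that by (intro sum.cong) (auto simp: Q_def)
    also have "\<dots> = M $$ (i, b k)"
      using b_less that by simp
    finally show ?thesis .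
  qed
  have PQ: "P * Q = 1\<^sub>m N"
  proof (rule eq_matI)
    fix i j assume "i < dim_row (1\<^sub>m N :: complex mat)" "j < dim_col (1\<^sub>m N :: complex mat)"
    hence ij: "i < N" "j < N" by auto
    have "(P * Q) $$ (i, j) = P $$ (i, b j)"
      by (rule MQ[OF P ij])
    also have "\<dots> = (if b j = b i then 1 else 0)"
      unfolding P_def using ij(1) b_less[OF ij(2)] by simp
    also have "\<dots> = 1\<^sub>m N $$ (i, j)"
      unfolding b_inj[OF ij(2) ij(1)] using ij by auto
    finally show "(P * Q) $$ (i, j) = 1\<^sub>m N $$ (i, j)" .
  qed (use P Q in auto)
  have QP: "Q * P = 1\<^sub>m N"
    by (rule mat_mult_left_right_inverse[OF P Q PQ])
  have "?B = P * ?A * Q"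
  proof (rule eq_matI)
    fix i j assume "i < dim_row (P * ?A * Q)" "j < dim_col (P * ?A * Q)"
    hence ij: "i < N" "j < N" using P Q by auto
    have "(P * ?A * Q) $$ (i, j) = ?A $$ (b i, b j)"
      using MQ[of "P * ?A", OF _ ij] PM[OF A ij(1) b_less[OF ij(2)]] P A by auto
    thus "?B $$ (i, j) = (P * ?A * Q) $$ (i, j)"
      using ij b_less inv_b by (simp add: adjacency_mat_def N_def)
  qed (use A B P Q in auto)
  thus ?thesis
    using A B P Q PQ QP by (intro similar_matI[of _ _ P Q N]) auto
qed

lemma energy_eq:
  assumes "vertex_labeling G \<sigma>"
  shows "energy G = mat_energy (adjacency_mat G \<sigma>)"
proof -
  let ?A = "adjacency_mat G (SOME \<sigma>. vertex_labeling G \<sigma>)" and ?B = "adjacency_mat G \<sigma>"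
  have "vertex_labeling G (SOME \<sigma>. vertex_labeling G \<sigma>)"
    using assms by (rule someI[of "vertex_labeling G"])
  hence "char_poly ?A = char_poly ?B"
    by (rule char_poly_similar[OF similar_adjacency_mat[OF assms]])
  moreover have "?A \<in> carrier_mat (card (pverts G)) (card (pverts G))"
      "?B \<in> carrier_mat (card (pverts G)) (card (pverts G))"
    by (auto simp: adjacency_mat_def)
  ultimately show ?thesis
    by (simp add: energy_def mat_energy_def eigenvalue_root_char_poly)
qed

end

theory Submission
  imports Defs "Jordan_Normal_Form.Schur_Decomposition" "HOL-Number_Theory.Cong"
begin

text \<open>
  The adjacency matrix of \<open>G \<box> H\<close> is a Kronecker sum \<open>A \<otimes> 1 + 1 \<otimes> B\<close>, so its eigenvalues are the sums
  \<open>\<lambda>\<^sub>i + \<mu>\<^sub>j\<close>.  As \<open>B\<close> has trace zero, \<open>\<Sum>\<^sub>j |\<lambda>\<^sub>i + \<mu>\<^sub>j| \<ge> N\<^sub>2 |\<lambda>\<^sub>i|\<close>; hence the energy is at least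
  \<open>N\<^sub>2 E(G)\<close>, likewise at least \<open>N\<^sub>1 E(H)\<close>, and so at least their mean.

  By Parseval \<open>\<parallel>F A F\<parallel>\<^sub>2 = \<parallel>A\<parallel>\<^sub>2 = \<surd>(2 s)\<close>, so \<open>\<kappa>(G)\<close> is the minimum of \<open>\<parallel>F A F\<parallel>\<^sub>1 / E(G)\<close>.  For coprime orders,
  the Chinese remainder labeling turns \<open>F\<close> into \<open>F\<^sub>1 \<otimes> F\<^sub>2\<close>, and
  \<open>F A F = (F\<^sub>1 A\<^sub>G F\<^sub>1) \<otimes> F\<^sub>2\<^sup>2 + F\<^sub>1\<^sup>2 \<otimes> (F\<^sub>2 A\<^sub>H F\<^sub>2)\<close>.  Since \<open>F\<^sub>i\<^sup>2\<close> is a permutation matrix, the \<open>\<ell>\<^sup>1\<close>-norm is at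
  most \<open>N\<^sub>2 \<parallel>F\<^sub>1 A\<^sub>G F\<^sub>1\<parallel>\<^sub>1 + N\<^sub>1 \<parallel>F\<^sub>2 A\<^sub>H F\<^sub>2\<parallel>\<^sub>1\<close>, and the bound on the energy finishes the proof.
\<close>

section \<open>Spectra of Kronecker sums\<close>

lemma order_prod_list_linear:
  "Polynomial.order \<mu> (\<Prod>a\<leftarrow>es. [:- a, 1:]) = count_list es (\<mu> :: 'a :: idom)"
proof (induction es)
  case (Cons a es)
  have "(\<Prod>a\<leftarrow>a # es. [:- a, 1:]) \<noteq> 0"
    unfolding prod_list_zero_iff by auto
  hence nz: "[:- a, 1:] * (\<Prod>a\<leftarrow>es. [:- a, 1:]) \<noteq> 0"
    by (simp only: list.map prod_list.Cons not_False_eq_True)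
  have "Polynomial.order \<mu> [:- a, 1:] = (if a = \<mu> then 1 else 0)"
    using order_power_n_n[of a 1] by (auto intro!: order_0I)
  thus ?case
    using Cons.IH by (simp only: list.map prod_list.Cons order_mult[OF nz]) simp
qed (simp add: order_0I)

lemma sum_list_map_eq_sum_count_real:
  "sum_list (map f xs) = (\<Sum>x\<in>set xs. real (count_list xs x) * f x)"
proof (induction xs)
  case (Cons a xs)
  have "(\<Sum>x\<in>set (a # xs). real (count_list (a # xs) x) * f x) =
      (\<Sum>x\<in>insert a (set xs). (if x = a then f a else 0) + real (count_list xs x) * f x)"
    by (intro sum.cong) (auto simp: algebra_simps)
  also have "\<dots> = f a + (\<Sum>x\<in>insert a (set xs). real (count_list xs x) * f x)"
    by (simp add: sum.distrib)
  also have "(\<Sum>x\<in>insert a (set xs). real (count_list xs x) * f x) =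
      (\<Sum>x\<in>set xs. real (count_list xs x) * f x)"
    by (intro sum.mono_neutral_right) (auto simp: count_list_0_iff)
  finally show ?case
    using Cons.IH by simp
qed simp

text \<open>Similarity preserves the characteristic polynomial, and that of \<open>T\<close> is the
  product of linear factors over its diagonal; so the diagonal lists the eigenvalues with algebraic
  multiplicity.\<close>

lemma mat_energy_upper_triangular:
  assumes A: "A \<in> carrier_mat n n" and T: "T \<in> carrier_mat n n" "upper_triangular T"
    and sim: "similar_mat A T"
  shows "mat_energy A = (\<Sum>i<n. cmod (T $$ (i, i)))"
proof -
  have cp: "char_poly A = (\<Prod>a\<leftarrow>diag_mat T. [:- a, 1:])"
    using char_poly_similar[OF sim] char_poly_upper_triangular[OF T] by simp
  have "{\<mu>. eigenvalue A \<mu>} = set (diag_mat T)"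
    unfolding eigenvalue_root_char_poly[OF A] cp
    by (auto simp: poly_prod_list prod_list_zero_iff)
  hence "mat_energy A = (\<Sum>\<mu>\<in>set (diag_mat T). count_list (diag_mat T) \<mu> * cmod \<mu>)"
    unfolding mat_energy_def cp order_prod_list_linear by simp
  also have "\<dots> = (\<Sum>\<mu>\<leftarrow>diag_mat T. cmod \<mu>)"
    by (rule sum_list_map_eq_sum_count_real [symmetric])
  also have "\<dots> = (\<Sum>i<n. cmod (T $$ (i, i)))"
    using T(1) by (simp add: diag_mat_def comp_def interv_sum_list_conv_sum_set_nat lessThan_atLeast0)
  finally show ?thesis .
qed

text \<open>Over the complex numbers the characteristic polynomial splits, so a Schur decomposition
  exists. The transformation matrices are exposed because those of two factors are later combined by
  \<open>kron\<close>.\<close>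

lemma similar_upper_triangular:
  assumes "(A :: complex mat) \<in> carrier_mat n n"
  obtains T P Q where "similar_mat_wit A T P Q" "upper_triangular T"
proof -
  obtain es where "char_poly A = (\<Prod>a\<leftarrow>es. [:- a, 1:])"
    using char_poly_factorized[OF assms] by blast
  then obtain T where "upper_triangular T" "similar_mat A T"
    using schur_decomposition_exists[OF assms] by blast
  with that show ?thesis
    unfolding similar_mat_def by blast
qed

section \<open>Traces and positivity of the energy\<close>

definition mat_trace :: "'a :: comm_monoid_add mat \<Rightarrow> 'a" where
  "mat_trace A = (\<Sum>i<dim_row A. A $$ (i, i))"

lemma index_mult_mat_sum:
  assumes "A \<in> carrier_mat n k" "B \<in> carrier_mat k m" "i < n" "j < m"
  shows "(A * B) $$ (i, j) = (\<Sum>l<k. A $$ (i, l) * B $$ (l, j))"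
  using assms by (auto simp: scalar_prod_def lessThan_atLeast0)

lemma mat_trace_mult_commute:
  fixes A :: "'a :: comm_semiring_0 mat"
  assumes "A \<in> carrier_mat n m" "B \<in> carrier_mat m n"
  shows "mat_trace (A * B) = mat_trace (B * A)"
proof -
  have "mat_trace (A * B) = (\<Sum>i<n. \<Sum>j<m. A $$ (i, j) * B $$ (j, i))"
    using assms by (simp add: mat_trace_def index_mult_mat_sum[OF assms] del: index_mult_mat(1))
  also have "\<dots> = (\<Sum>j<m. \<Sum>i<n. B $$ (j, i) * A $$ (i, j))"
    by (subst sum.swap) (simp add: mult.commute)
  also have "\<dots> = mat_trace (B * A)"
    using assms by (simp add: mat_trace_def index_mult_mat_sum[OF assms(2,1)] del: index_mult_mat(1))
  finally show ?thesis .
qed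

text \<open>Cyclicity of the trace brings \<open>P\<close> next to its inverse
  \<open>Q\<close>.\<close>

lemma mat_trace_similar:
  assumes "similar_mat_wit (A :: 'a :: comm_ring_1 mat) B P Q"
  shows "mat_trace A = mat_trace B"
proof -
  define n where "n = dim_row A"
  note w = similar_mat_witD[OF n_def assms]
  have "mat_trace A = mat_trace (P * (B * Q))"
    using w by simp
  also have "\<dots> = mat_trace (B * Q * P)"
    using w by (intro mat_trace_mult_commute[of _ n n]) auto
  also have "B * Q * P = B"
    using w by (simp add: assoc_mult_mat[of _ n n _ n _ n])
  finally show ?thesis .
qed

text \<open>The trace of \<open>A * A\<close> is the sum of the squared eigenvalues, so some
  eigenvalue is nonzero.\<close>

lemma mat_energy_pos:
  fixes A :: "complex mat"
  assumes A: "A \<in> carrier_mat n n" and tr: "mat_trace (A * A) \<noteq> 0"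
  shows "mat_energy A > 0"
proof -
  obtain T P Q where w: "similar_mat_wit A T P Q" and T: "upper_triangular T"
    using similar_upper_triangular[OF A] .
  note wD = similar_mat_witD2[OF A w]
  have E: "mat_energy A = (\<Sum>i<n. cmod (T $$ (i, i)))"
    using w wD T A by (intro mat_energy_upper_triangular) (auto simp: similar_mat_def)
  have "similar_mat_wit (A * A) (T * T) P Q"
    using similar_mat_wit_pow[OF w, of 2] wD by (simp add: numeral_2_eq_2)
  hence "mat_trace (A * A) = mat_trace (T * T)"
    by (rule mat_trace_similar)
  also have "\<dots> = (\<Sum>i<n. \<Sum>j<n. T $$ (i, j) * T $$ (j, i))"
    using wD by (simp add: mat_trace_def index_mult_mat_sum[of _ n n _ n] del: index_mult_mat(1))
  \<comment> \<open>For \<open>i \<noteq> j\<close>, one of \<open>T $$ (i, j)\<close> and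
    \<open>T $$ (j, i)\<close> lies below the diagonal.\<close>
  also have "\<dots> = (\<Sum>i<n. \<Sum>j<n. if j = i then (T $$ (i, i))\<^sup>2 else 0)"
  proof (intro sum.cong refl)
    fix i j assume ij: "i \<in> {..<n}" "j \<in> {..<n}"
    show "T $$ (i, j) * T $$ (j, i) = (if j = i then (T $$ (i, i))\<^sup>2 else 0)"
      using upper_triangularD[OF T, of j i] upper_triangularD[OF T, of i j] ij wD
      by (cases i j rule: linorder_cases) (auto simp: power2_eq_square)
  qed
  also have "\<dots> = (\<Sum>i<n. (T $$ (i, i))\<^sup>2)"
    by simp
  finally have "(\<Sum>i<n. (T $$ (i, i))\<^sup>2) \<noteq> 0"
    using tr by simp
  then obtain i where "i < n" "T $$ (i, i) \<noteq> 0"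
    by (rule sum.not_neutral_contains_not_neutral) auto
  thus ?thesis
    unfolding E by (intro sum_pos2[of _ i]) auto
qed

section \<open>Kronecker products, Kronecker sums and the energy bound\<close>

text \<open>A row index \<open>i\<close> encodes the pair of \<open>i div dim_row B\<close> and
  \<open>i mod dim_row B\<close>, so pairs are ordered lexicographically; preservation of triangular
  form relies on this order.\<close>

definition kron :: "'a :: semiring_0 mat \<Rightarrow> 'a mat \<Rightarrow> 'a mat" where
  "kron A B = mat (dim_row A * dim_row B) (dim_col A * dim_col B)
     (\<lambda>(i, j). A $$ (i div dim_row B, j div dim_col B) * B $$ (i mod dim_row B, j mod dim_col B))"

lemma kron_carrier:
  "A \<in> carrier_mat n1 m1 \<Longrightarrow> B \<in> carrier_mat n2 m2 \<Longrightarrow> kron A B \<in> carrier_mat (n1 * n2) (m1 * m2)"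
  by (auto simp: kron_def)

lemma sum_div_mod:
  fixes f :: "nat \<Rightarrow> nat \<Rightarrow> 'a :: comm_monoid_add"
  shows "(\<Sum>k<n * m. f (k div m) (k mod m)) = (\<Sum>i<n. \<Sum>j<m. f i j)"
proof -
  have "(\<Sum>i<n. \<Sum>j<m. f i j) = (\<Sum>(i, j)\<in>{..<n} \<times> {..<m}. f i j)"
    by (simp add: sum.cartesian_product)
  also have "\<dots> = (\<Sum>k<n * m. f (k div m) (k mod m))"
  proof (rule sum.reindex_bij_witness[of _ "\<lambda>k. (k div m, k mod m)" "\<lambda>(i, j). i * m + j"])
    fix k assume "k \<in> {..<n * m}"
    moreover from this have "0 < m"
      by (cases m) auto
    ultimately show "(k div m, k mod m) \<in> {..<n} \<times> {..<m}"
      by (auto simp: less_mult_imp_div_less)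
  next
    fix p assume "p \<in> {..<n} \<times> {..<m}"
    then obtain i j where p: "p = (i, j)" "i < n" "j < m"
      by auto
    have "i * m + j < Suc i * m"
      using p by simp
    also have "\<dots> \<le> n * m"
      using p by (intro mult_right_mono) auto
    finally show "(case p of (i, j) \<Rightarrow> i * m + j) \<in> {..<n * m}"
      using p by simp
  qed auto
  finally show ?thesis ..
qed

text \<open>Splitting the inner index into quotient and remainder gives a double sum, which factors
  into one sum per component.\<close>

lemma kron_mult:
  fixes A B C D :: "'a :: comm_semiring_0 mat"
  assumes A: "A \<in> carrier_mat n n" and B: "B \<in> carrier_mat m m"
    and C: "C \<in> carrier_mat n n" and D: "D \<in> carrier_mat m m"
  shows "kron A B * kron C D = kron (A * C) (B * D)"
proof (rule eq_matI)
  fix i j assume "i < dim_row (kron (A * C) (B * D))" "j < dim_col (kron (A * C) (B * D))"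
  hence ij: "i < n * m" "j < n * m"
    using assms by (auto simp: kron_def)
  hence "m > 0"
    by (cases m) auto
  have dm: "i div m < n" "j div m < n" "i mod m < m" "j mod m < m"
    using ij \<open>m > 0\<close> by (auto simp: less_mult_imp_div_less)
  have "(kron A B * kron C D) $$ (i, j) = (\<Sum>k<n * m. kron A B $$ (i, k) * kron C D $$ (k, j))"
    by (rule index_mult_mat_sum) (use assms ij in \<open>auto intro: kron_carrier\<close>)
  also have "\<dots> = (\<Sum>k<n * m. (A $$ (i div m, k div m) * C $$ (k div m, j div m)) *
      (B $$ (i mod m, k mod m) * D $$ (k mod m, j mod m)))"
    using assms ij by (intro sum.cong) (auto simp: kron_def ac_simps)
  also have "\<dots> = (\<Sum>k<n. \<Sum>l<m. (A $$ (i div m, k) * C $$ (k, j div m)) *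
      (B $$ (i mod m, l) * D $$ (l, j mod m)))"
    by (rule sum_div_mod)
  also have "\<dots> = (A * C) $$ (i div m, j div m) * (B * D) $$ (i mod m, j mod m)"
    unfolding index_mult_mat_sum[OF A C dm(1,2)] index_mult_mat_sum[OF B D dm(3,4)]
    by (rule sum_product [symmetric])
  also have "\<dots> = kron (A * C) (B * D) $$ (i, j)"
    using assms ij by (simp add: kron_def del: index_mult_mat(1))
  finally show "(kron A B * kron C D) $$ (i, j) = kron (A * C) (B * D) $$ (i, j)" .
qed (use assms in \<open>auto simp: kron_def\<close>)

lemma kron_one: "kron (1\<^sub>m n) (1\<^sub>m m :: 'a :: semiring_1 mat) = 1\<^sub>m (n * m)"
proof (rule eq_matI)
  fix i j assume "i < dim_row (1\<^sub>m (n * m) :: 'a mat)" "j < dim_col (1\<^sub>m (n * m) :: 'a mat)"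
  hence ij: "i < n * m" "j < n * m"
    by auto
  hence "m > 0"
    by (cases m) auto
  moreover have "i = j \<longleftrightarrow> i div m = j div m \<and> i mod m = j mod m"
    by (metis div_mult_mod_eq)
  ultimately show "kron (1\<^sub>m n) (1\<^sub>m m) $$ (i, j) = (1\<^sub>m (n * m) :: 'a mat) $$ (i, j)"
    using ij by (auto simp: kron_def less_mult_imp_div_less)
qed (auto simp: kron_def)

definition kron_sum :: "'a :: semiring_1 mat \<Rightarrow> 'a mat \<Rightarrow> 'a mat" where
  "kron_sum A B = kron A (1\<^sub>m (dim_row B)) + kron (1\<^sub>m (dim_row A)) B"

lemma kron_sum_carrier:
  "A \<in> carrier_mat n n \<Longrightarrow> B \<in> carrier_mat m m \<Longrightarrow> kron_sum A B \<in> carrier_mat (n * m) (n * m)"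
  unfolding kron_sum_def by (auto intro!: add_carrier_mat kron_carrier)

lemma index_kron_sum:
  assumes "A \<in> carrier_mat n n" "B \<in> carrier_mat m m" "i < n * m" "j < n * m"
  shows "kron_sum A B $$ (i, j) =
    (if i mod m = j mod m then A $$ (i div m, j div m) else 0) +
    (if i div m = j div m then B $$ (i mod m, j mod m) else 0)"
proof -
  have "m > 0"
    using assms by (cases m) auto
  thus ?thesis
    using assms by (simp add: kron_sum_def kron_def less_mult_imp_div_less)
qed

text \<open>By the mixed-product rule, (P \<otimes> Q)(T \<otimes> 1)(P' \<otimes> Q') = PTP'
  \<otimes> QQ' = A \<otimes> 1, and symmetrically for the other summand.\<close>

lemma similar_mat_wit_kron_sum:
  fixes A B :: "'a :: comm_ring_1 mat"
  assumes A: "A \<in> carrier_mat n n" and B: "B \<in> carrier_mat m m"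
    and wA: "similar_mat_wit A T P P'" and wB: "similar_mat_wit B U Q Q'"
  shows "similar_mat_wit (kron_sum A B) (kron_sum T U) (kron P Q) (kron P' Q')"
proof -
  note a = similar_mat_witD2[OF A wA] and b = similar_mat_witD2[OF B wB]
  have k: "kron X Y \<in> carrier_mat (n * m) (n * m)"
    if "X \<in> carrier_mat n n" "Y \<in> carrier_mat m m" for X Y :: "'a mat"
    using that by (rule kron_carrier)
  have "kron P Q * kron_sum T U * kron P' Q' =
      (kron P Q * kron T (1\<^sub>m m) + kron P Q * kron (1\<^sub>m n) U) * kron P' Q'"
    unfolding kron_sum_def using a b
    by (simp add: mult_add_distrib_mat[of _ "n * m" "n * m" _ "n * m"] k)
  also have "\<dots> = kron (P * T) Q * kron P' Q' + kron P (Q * U) * kron P' Q'"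
    using a b by (simp add: add_mult_distrib_mat[of _ "n * m" "n * m" _ _ "n * m"] k
        kron_mult[of _ n _ m])
  also have "\<dots> = kron A (1\<^sub>m m) + kron (1\<^sub>m n) B"
    using a b by (simp add: kron_mult[of _ n _ m])
  also have "\<dots> = kron_sum A B"
    using A B by (simp add: kron_sum_def)
  finally have "kron_sum A B = kron P Q * kron_sum T U * kron P' Q'" ..
  thus ?thesis
    using a b A B
    by (intro similar_mat_witI[of _ _ "n * m"] kron_sum_carrier k)
      (auto simp: kron_mult[of _ n _ m] kron_one)
qed

text \<open>Below the diagonal, equal remainders force a strictly smaller column quotient, and equal
  quotients a strictly smaller column remainder. Each surviving term is thus an entry of
  \<open>T\<close> or \<open>U\<close> below its own diagonal.\<close>

lemma upper_triangular_kron_sum: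
  assumes T: "T \<in> carrier_mat n n" "upper_triangular T"
    and U: "U \<in> carrier_mat m m" "upper_triangular U"
  shows "upper_triangular (kron_sum T U)"
proof (rule upper_triangularI)
  fix i j assume ji: "j < i" and "i < dim_row (kron_sum T U)"
  hence i: "i < n * m"
    using kron_sum_carrier[OF T(1) U(1)] by auto
  hence m: "m > 0"
    by (cases m) auto
  have le: "j div m \<le> i div m"
    using ji by (simp add: div_le_mono)
  have *: "i div m < n" "i mod m < m"
    using i m by (auto simp: less_mult_imp_div_less)
  have 1: "T $$ (i div m, j div m) = 0" if "i mod m = j mod m"
  proof -
    have "i div m \<noteq> j div m"
      using that ji by (metis div_mult_mod_eq less_irrefl)
    thus ?thesis
      using le * T by (intro upper_triangularD[OF T(2)]) auto
  qed
  have 2: "U $$ (i mod m, j mod m) = 0" if "i div m = j div m"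
  proof -
    have "j mod m < i mod m"
      using that ji by (metis div_mult_mod_eq nat_add_left_cancel_less)
    thus ?thesis
      using * U by (intro upper_triangularD[OF U(2)]) auto
  qed
  show "kron_sum T U $$ (i, j) = 0"
    using ji i 1 2 by (simp add: index_kron_sum[OF T(1) U(1)])
qed

lemma mat_energy_kron_sum_ge:
  assumes A: "A \<in> carrier_mat n n" and B: "B \<in> carrier_mat m m"
    and trA: "mat_trace A = 0" and trB: "mat_trace B = 0"
  shows "mat_energy (kron_sum A B) \<ge> real m * mat_energy A"
    and "mat_energy (kron_sum A B) \<ge> real n * mat_energy B"
proof -
  obtain T P P' where wA: "similar_mat_wit A T P P'" and T: "upper_triangular T"
    using similar_upper_triangular[OF A] .
  obtain U Q Q' where wB: "similar_mat_wit B U Q Q'" and U: "upper_triangular U"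
    using similar_upper_triangular[OF B] .
  note a = similar_mat_witD2[OF A wA] and b = similar_mat_witD2[OF B wB]
  define s where "s = (\<lambda>i. T $$ (i, i))"
  define t where "t = (\<lambda>j. U $$ (j, j))"
  have EA: "mat_energy A = (\<Sum>i<n. cmod (s i))"
    unfolding s_def using wA a T A
    by (intro mat_energy_upper_triangular) (auto simp: similar_mat_def)
  have EB: "mat_energy B = (\<Sum>j<m. cmod (t j))"
    unfolding t_def using wB b U B
    by (intro mat_energy_upper_triangular) (auto simp: similar_mat_def)
  have "mat_energy (kron_sum A B) = (\<Sum>k<n * m. cmod (kron_sum T U $$ (k, k)))"
    using similar_mat_wit_kron_sum[OF A B wA wB] a b T U A B
    by (intro mat_energy_upper_triangular kron_sum_carrier upper_triangular_kron_sum)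
      (auto simp: similar_mat_def)
  also have "\<dots> = (\<Sum>k<n * m. cmod (s (k div m) + t (k mod m)))"
    using a b by (intro sum.cong) (auto simp: index_kron_sum s_def t_def)
  also have "\<dots> = (\<Sum>i<n. \<Sum>j<m. cmod (s i + t j))"
    by (rule sum_div_mod)
  finally have E: "mat_energy (kron_sum A B) = (\<Sum>i<n. \<Sum>j<m. cmod (s i + t j))" .
  \<comment> \<open>Trace zero passes from \<open>A\<close> and \<open>B\<close> to the triangular
    forms by similarity.\<close>
  have s0: "(\<Sum>i<n. s i) = 0"
    using trA mat_trace_similar[OF wA] a by (simp add: mat_trace_def s_def)
  have t0: "(\<Sum>j<m. t j) = 0"
    using trB mat_trace_similar[OF wB] b by (simp add: mat_trace_def t_def)
  \<comment> \<open>The numbers \<open>s i + t j\<close> sum over \<open>j\<close> to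
    \<open>m * s i\<close>, so this is the triangle inequality.\<close>
  have "real m * cmod (s i) \<le> (\<Sum>j<m. cmod (s i + t j))" for i
    using norm_sum[of "\<lambda>j. s i + t j" "{..<m}"] t0 by (simp add: sum.distrib norm_mult)
  thus "mat_energy (kron_sum A B) \<ge> real m * mat_energy A"
    unfolding E EA sum_distrib_left by (intro sum_mono)
  have "real n * cmod (t j) \<le> (\<Sum>i<n. cmod (s i + t j))" for j
    using norm_sum[of "\<lambda>i. s i + t j" "{..<n}"] s0 by (simp add: sum.distrib norm_mult)
  thus "mat_energy (kron_sum A B) \<ge> real n * mat_energy B"
    unfolding E EB sum_distrib_left by (subst sum.swap) (intro sum_mono)
qed

section \<open>Characters of cyclic groups and the Fourier matrix\<close>

text \<open>A character of the integers modulo \<open>N\<close>, with the sign of the Fourier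
  matrix. The argument is an integer, so that conjugation becomes negation and differences of labels
  can be inserted.\<close>

definition fourier_char :: "nat \<Rightarrow> int \<Rightarrow> complex" where
  "fourier_char N k = cis (- (2 * pi * of_int k / of_nat N))"

lemma fourier_char_add: "fourier_char N (j + k) = fourier_char N j * fourier_char N k"
  by (simp add: fourier_char_def cis_mult algebra_simps add_divide_distrib)

lemma cnj_fourier_char: "cnj (fourier_char N k) = fourier_char N (- k)"
  by (simp add: fourier_char_def cis_cnj)

lemma fourier_char_mult_nat: "fourier_char N (k * int n) = fourier_char N k ^ n"
  by (simp add: fourier_char_def DeMoivre algebra_simps)

lemma fourier_char_eq_1_iff:
  assumes "N > 0"
  shows "fourier_char N k = 1 \<longleftrightarrow> int N dvd k"
proof
  assume "fourier_char N k = 1"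
  \<comment> \<open>The real part alone forces the angle to be a multiple of 2 pi.\<close>
  hence "cos (2 * pi * of_int k / of_nat N) = 1"
    by (simp add: fourier_char_def complex_eq_iff)
  then obtain n :: int where "2 * pi * of_int k / of_nat N = of_int n * 2 * pi"
    unfolding cos_one_2pi_int by blast
  hence "real_of_int k = of_int (int N * n)"
    using assms by (simp add: field_simps)
  thus "int N dvd k"
    by (simp only: of_int_eq_iff dvd_triv_left)
next
  assume "int N dvd k"
  then obtain n where k: "k = int N * n" ..
  have "cis (2 * pi * of_int (- n)) = 1"
    by (rule cis_multiple_2pi) auto
  thus "fourier_char N k = 1"
    using assms by (simp add: fourier_char_def k ac_simps)
qed

lemma fourier_char_cong:
  assumes "N > 0" "[j = k] (mod int N)"
  shows "fourier_char N j = fourier_char N k"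
proof -
  have "fourier_char N (j - k) = 1"
    using assms by (simp add: fourier_char_eq_1_iff cong_iff_dvd_diff)
  thus ?thesis
    using fourier_char_add[of N "j - k" k] by simp
qed

text \<open>Through this, a multiple of \<open>M\<close> in a label modulo \<open>N * M\<close> is
  seen by a character of the factor of order \<open>N\<close>.\<close>

lemma fourier_char_cancel:
  "M > 0 \<Longrightarrow> fourier_char (N * M) (int M * k) = fourier_char N k"
  by (simp add: fourier_char_def ac_simps)

text \<open>Orthogonality of characters: a geometric series whose ratio is an \<open>N\<close>-th
  root of unity, equal to 1 exactly when \<open>N\<close> divides \<open>k\<close>.\<close>

lemma sum_fourier_char:
  assumes "N > 0"
  shows "(\<Sum>x<N. fourier_char N (k * int x)) = (if int N dvd k then of_nat N else 0)"
proof (cases "int N dvd k")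
  case True
  hence "fourier_char N k = 1"
    by (simp add: fourier_char_eq_1_iff assms)
  thus ?thesis
    using True by (simp add: fourier_char_mult_nat)
next
  case False
  hence "fourier_char N k \<noteq> 1"
    by (simp add: fourier_char_eq_1_iff assms)
  moreover have "fourier_char N k ^ N = 1"
    using assms by (simp flip: fourier_char_mult_nat add: fourier_char_eq_1_iff)
  ultimately show ?thesis
    using False by (simp add: fourier_char_mult_nat geometric_sum)
qed

section \<open>The Fourier matrix and Parseval's identity\<close>

lemma index_fourier_mat:
  assumes "m < N" "x < N"
  shows "fourier_mat N $$ (m, x) = fourier_char N (int m * int x) / complex_of_real (sqrt (real N))"
proof -
  have "- 2 * complex_of_real pi * \<i> * of_nat m * of_nat x / of_nat N =
      \<i> * complex_of_real (- (2 * pi * of_int (int m * int x) / of_nat N))"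
    by simp
  thus ?thesis
    using assms by (simp add: fourier_mat_def fourier_char_def cis_conv_exp ac_simps)
qed

text \<open>After expanding the squared moduli and summing over \<open>m\<close> first,
  orthogonality leaves only the terms with \<open>x = y\<close>. Since \<open>v\<close> is an
  arbitrary function, it may be a row or a column of a matrix.\<close>

lemma fourier_mat_parseval:
  assumes N: "N > 0"
  shows "(\<Sum>m<N. (cmod (\<Sum>x<N. fourier_mat N $$ (m, x) * v x))\<^sup>2) = (\<Sum>x<N. (cmod (v x))\<^sup>2)"
proof -
  let ?e = "fourier_char N"
  have "complex_of_real (\<Sum>m<N. (cmod (\<Sum>x<N. fourier_mat N $$ (m, x) * v x))\<^sup>2) =
      (\<Sum>m<N. (\<Sum>x<N. fourier_mat N $$ (m, x) * v x) *
        (\<Sum>y<N. cnj (fourier_mat N $$ (m, y) * v y)))"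
    unfolding of_real_sum complex_norm_square cnj_sum ..
  also have "\<dots> = (\<Sum>m<N. \<Sum>x<N. \<Sum>y<N. v x * cnj (v y) / of_nat N *
      ?e ((int x - int y) * int m))"
  proof (intro sum.cong refl, unfold sum_product, intro sum.cong refl)
    fix m x y assume "m \<in> {..<N}" "x \<in> {..<N}" "y \<in> {..<N}"
    hence "fourier_mat N $$ (m, x) * v x * cnj (fourier_mat N $$ (m, y) * v y) =
        v x * cnj (v y) / (of_real (sqrt N) * of_real (sqrt N)) *
          (?e (int m * int x) * ?e (- (int m * int y)))"
      by (simp add: index_fourier_mat cnj_fourier_char)
    also have "complex_of_real (sqrt N) * of_real (sqrt N) = of_nat N"
      by (simp flip: of_real_mult)
    also have "?e (int m * int x) * ?e (- (int m * int y)) = ?e ((int x - int y) * int m)"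
      by (simp flip: fourier_char_add add: algebra_simps)
    finally show "fourier_mat N $$ (m, x) * v x * cnj (fourier_mat N $$ (m, y) * v y) =
      v x * cnj (v y) / of_nat N * ?e ((int x - int y) * int m)" .
  qed
  also have "\<dots> = (\<Sum>x<N. \<Sum>y<N. v x * cnj (v y) / of_nat N * (\<Sum>m<N. ?e ((int x - int y) * int m)))"
    unfolding sum_distrib_left by (subst sum.swap, rule sum.cong[OF refl], rule sum.swap)
  also have "\<dots> = (\<Sum>x<N. \<Sum>y<N. if y = x then v x * cnj (v x) else 0)"
  proof (intro sum.cong refl)
    fix x y assume "x \<in> {..<N}" "y \<in> {..<N}"
    \<comment> \<open>Both indices lie below \<open>N\<close>, so their difference is a multiple of
      \<open>N\<close> only if it is zero.\<close>
    hence "int N dvd int x - int y \<longleftrightarrow> y = x"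
      using N by (auto simp: mod_eq_dvd_iff[symmetric])
    thus "v x * cnj (v y) / of_nat N * (\<Sum>m<N. ?e ((int x - int y) * int m)) =
        (if y = x then v x * cnj (v x) else 0)"
      using N by (simp add: sum_fourier_char)
  qed
  also have "\<dots> = complex_of_real (\<Sum>x<N. (cmod (v x))\<^sup>2)"
    unfolding of_real_sum complex_norm_square by simp
  finally show ?thesis
    by (simp only: of_real_eq_iff)
qed

lemma fourier_mat_carrier [simp]: "fourier_mat N \<in> carrier_mat N N"
  by (simp add: fourier_mat_def)

lemma fourier_mat_sym: "m < N \<Longrightarrow> x < N \<Longrightarrow> fourier_mat N $$ (m, x) = fourier_mat N $$ (x, m)"
  by (simp add: index_fourier_mat mult.commute)

text \<open>Parseval is applied twice, first to each column of \<open>M * fourier_mat N\<close> and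
  then to each row of \<open>M\<close>; symmetry of the Fourier matrix turns right multiplication
  into a transform of rows.\<close>

lemma frobenius_norm_fourier:
  assumes N: "N > 0" and M: "M \<in> carrier_mat N N"
  shows "frobenius_norm (fourier_mat N * M * fourier_mat N) = frobenius_norm M"
proof -
  let ?F = "fourier_mat N"
  have MF: "M * ?F \<in> carrier_mat N N"
    using M by simp
  have "(\<Sum>m<N. \<Sum>n<N. (cmod ((?F * M * ?F) $$ (m, n)))\<^sup>2) =
      (\<Sum>n<N. \<Sum>m<N. (cmod ((?F * (M * ?F)) $$ (m, n)))\<^sup>2)"
    using M by (subst sum.swap) (simp add: assoc_mult_mat[of _ N N _ N _ N])
  also have "\<dots> = (\<Sum>n<N. \<Sum>m<N. (cmod (\<Sum>x<N. ?F $$ (m, x) * (M * ?F) $$ (x, n)))\<^sup>2)"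
    by (intro sum.cong refl) (simp add: index_mult_mat_sum[OF fourier_mat_carrier MF] del: index_mult_mat(1))
  also have "\<dots> = (\<Sum>x<N. \<Sum>n<N. (cmod ((M * ?F) $$ (x, n)))\<^sup>2)"
    unfolding fourier_mat_parseval[OF N] by (rule sum.swap)
  also have "\<dots> = (\<Sum>x<N. \<Sum>n<N. (cmod (\<Sum>y<N. ?F $$ (n, y) * M $$ (x, y)))\<^sup>2)"
    using M by (intro sum.cong refl arg_cong[where f = "\<lambda>z. (cmod z)\<^sup>2"])
      (simp add: index_mult_mat_sum[OF M fourier_mat_carrier] fourier_mat_sym mult.commute del: index_mult_mat(1))
  also have "\<dots> = (\<Sum>x<N. \<Sum>y<N. (cmod (M $$ (x, y)))\<^sup>2)"
    unfolding fourier_mat_parseval[OF N] ..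
  finally show ?thesis
    using M by (simp add: frobenius_norm_def fourier_mat_def)
qed

section \<open>Sums over residues\<close>

text \<open>The Chinese remainder theorem as a change of summation index: coprimality makes the pair
  of residues injective, and both index sets have \<open>N1 * N2\<close> elements.\<close>

lemma sum_mod_mod:
  fixes f :: "nat \<Rightarrow> nat \<Rightarrow> 'a :: comm_monoid_add"
  assumes "coprime N1 N2"
  shows "(\<Sum>m<N1 * N2. f (m mod N1) (m mod N2)) = (\<Sum>a<N1. \<Sum>b<N2. f a b)"
proof -
  let ?g = "\<lambda>m. (m mod N1, m mod N2)"
  have inj: "inj_on ?g {..<N1 * N2}"
  proof (rule inj_onI)
    fix m n assume mn: "m \<in> {..<N1 * N2}" "n \<in> {..<N1 * N2}" "?g m = ?g n"
    hence "[m = n] (mod N1 * N2)"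
      using assms by (intro coprime_cong_mult_nat) (auto simp: cong_def)
    thus "m = n"
      using mn by (simp add: cong_def)
  qed
  have "?g ` {..<N1 * N2} = {..<N1} \<times> {..<N2}"
  proof (rule card_subset_eq)
    show "?g ` {..<N1 * N2} \<subseteq> {..<N1} \<times> {..<N2}"
      \<comment> \<open>If a modulus is zero, the range \<open>{..<N1 * N2}\<close> is empty;
        otherwise residues lie below their moduli.\<close>
      by (cases "N1 = 0 \<or> N2 = 0") auto
  qed (auto simp: card_image[OF inj])
  with inj have "bij_betw ?g {..<N1 * N2} ({..<N1} \<times> {..<N2})"
    by (simp add: bij_betw_def)
  from sum.reindex_bij_betw[OF this, of "\<lambda>(a, b). f a b"] show ?thesis
    by (simp add: sum.cartesian_product)
qed

text \<open>This counts the nonzero entries of the squared Fourier matrix, the permutation matrix of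
  negation modulo \<open>N\<close>: each \<open>a\<close> has exactly one partner.\<close>

lemma sum_of_bool_dvd_add:
  "(\<Sum>a<N. \<Sum>b<N. of_bool (N dvd a + b)) = (of_nat N :: 'a :: semiring_1)"
proof -
  have "(\<Sum>b<N. of_bool (N dvd a + b)) = (1 :: 'a)" if "a < N" for a
  proof -
    \<comment> \<open>The partner is the representative of \<open>- a\<close> below
      \<open>N\<close>. As \<open>a + b < 2 * N\<close>, the only possible multiples of
      \<open>N\<close> are \<open>0\<close> and \<open>N\<close>.\<close>
    have "(\<Sum>b<N. of_bool (N dvd a + b)) =
        (\<Sum>b<N. if b = (if a = 0 then 0 else N - a) then 1 else 0 :: 'a)"
    proof (intro sum.cong refl)
      fix b assume "b \<in> {..<N}"
      moreover have "a + b = 0 \<or> a + b = N" if "N dvd a + b"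
      proof -
        from that obtain k where k: "a + b = N * k" ..
        have "N * k < N * 2"
          using \<open>a < N\<close> \<open>b \<in> {..<N}\<close> by (simp flip: k)
        hence "k < 2"
          by simp
        thus ?thesis
          using k by (auto simp: less_2_cases_iff)
      qed
      ultimately have "N dvd a + b \<longleftrightarrow> b = (if a = 0 then 0 else N - a)"
        using \<open>a < N\<close> by auto
      thus "of_bool (N dvd a + b) =
          (if b = (if a = 0 then 0 else N - a) then 1 else 0 :: 'a)"
        by simp
    qed
    also have "\<dots> = 1"
      using that by simp
    finally show ?thesis .
  qed
  thus ?thesis
    by simp
qed

text \<open>Divisibility sees only the residues modulo \<open>N1\<close>, and \<open>f\<close> only
  those modulo \<open>N2\<close>, so the Chinese remainder theorem separates them. With moduli of
  entries for \<open>f\<close>, this is the entrywise norm of a Kronecker product with a squared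
  Fourier matrix.\<close>

lemma sum_of_bool_dvd_add_mod:
  fixes f :: "nat \<Rightarrow> nat \<Rightarrow> 'a :: comm_semiring_1"
  assumes "coprime N1 N2"
  shows "(\<Sum>m<N1 * N2. \<Sum>n<N1 * N2. of_bool (N1 dvd m + n) * f (m mod N2) (n mod N2)) =
    of_nat N1 * (\<Sum>b<N2. \<Sum>d<N2. f b d)"
proof -
  have dvd: "N1 dvd m + n \<longleftrightarrow> N1 dvd m mod N1 + n mod N1" for m n
    by (simp add: dvd_eq_mod_eq_0 mod_add_eq)
  have "(\<Sum>m<N1 * N2. \<Sum>n<N1 * N2. of_bool (N1 dvd m + n) * f (m mod N2) (n mod N2)) =
      (\<Sum>m<N1 * N2. \<Sum>c<N1. \<Sum>d<N2. of_bool (N1 dvd m mod N1 + c) * f (m mod N2) d)"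
  proof (rule sum.cong[OF refl])
    fix m
    show "(\<Sum>n<N1 * N2. of_bool (N1 dvd m + n) * f (m mod N2) (n mod N2)) =
        (\<Sum>c<N1. \<Sum>d<N2. of_bool (N1 dvd m mod N1 + c) * f (m mod N2) d)"
      using sum_mod_mod[OF assms, of "\<lambda>c d. of_bool (N1 dvd m mod N1 + c) * f (m mod N2) d"]
      by (simp only: dvd[symmetric])
  qed
  also have "\<dots> = (\<Sum>a<N1. \<Sum>b<N2. \<Sum>c<N1. \<Sum>d<N2. of_bool (N1 dvd a + c) * f b d)"
    by (rule sum_mod_mod[OF assms,
          of "\<lambda>a b. \<Sum>c<N1. \<Sum>d<N2. of_bool (N1 dvd a + c) * f b d"])
  also have "\<dots> = (\<Sum>a<N1. \<Sum>c<N1. of_bool (N1 dvd a + c) * (\<Sum>b<N2. \<Sum>d<N2. f b d))"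
    unfolding sum_distrib_left by (rule sum.cong[OF refl], rule sum.swap)
  also have "\<dots> = of_nat N1 * (\<Sum>b<N2. \<Sum>d<N2. f b d)"
    unfolding sum_of_bool_dvd_add[of N1, where ?'a = 'a, symmetric] sum_distrib_right ..
  finally show ?thesis .
qed

section \<open>Adjacency matrices\<close>

lemma vertex_labelingD:
  assumes "vertex_labeling G \<sigma>"
  shows "u \<in> pverts G \<Longrightarrow> \<sigma> u < card (pverts G)"
    and "u \<in> pverts G \<Longrightarrow> inv_into (pverts G) \<sigma> (\<sigma> u) = u"
    and "i < card (pverts G) \<Longrightarrow> inv_into (pverts G) \<sigma> i \<in> pverts G"
    and "i < card (pverts G) \<Longrightarrow> \<sigma> (inv_into (pverts G) \<sigma> i) = i"
proof -
  have bij: "inj_on \<sigma> (pverts G)" "\<sigma> ` pverts G = {0..<card (pverts G)}"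
    using assms by (auto simp: vertex_labeling_def bij_betw_def)
  show "\<sigma> u < card (pverts G)" "inv_into (pverts G) \<sigma> (\<sigma> u) = u" if "u \<in> pverts G"
    using that bij by auto
  show "inv_into (pverts G) \<sigma> i \<in> pverts G" "\<sigma> (inv_into (pverts G) \<sigma> i) = i"
    if "i < card (pverts G)"
    using that bij(2) by (auto intro!: inv_into_into f_inv_into_f)
qed

lemma adjacency_mat_carrier [simp]:
  "adjacency_mat G \<sigma> \<in> carrier_mat (card (pverts G)) (card (pverts G))"
  by (simp add: adjacency_mat_def)

lemma sum_vertex_labeling:
  assumes "vertex_labeling G \<sigma>"
  shows "(\<Sum>x<card (pverts G). f x) = (\<Sum>u\<in>pverts G. f (\<sigma> u))"
  using sum.reindex_bij_betw[of \<sigma> "pverts G" "{0..<card (pverts G)}" f] assms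
  by (simp add: vertex_labeling_def lessThan_atLeast0)

text \<open>Reindexed by vertices, the entries are the indicator of the arc set. The choice
  \<open>f = 1\<close> serves the trace of the square and the Frobenius norm; a product of Fourier
  entries gives the transform.\<close>

lemma sum_adjacency_mat:
  assumes G: "pair_graph G" and \<sigma>: "vertex_labeling G \<sigma>"
    and N: "N = card (pverts G)"
  shows "(\<Sum>x<N. \<Sum>y<N. adjacency_mat G \<sigma> $$ (x, y) * f x y) =
    (\<Sum>(u, v)\<in>parcs G. f (\<sigma> u) (\<sigma> v))"
proof -
  interpret pair_graph G by fact
  have "(\<Sum>x<N. \<Sum>y<N. adjacency_mat G \<sigma> $$ (x, y) * f x y) =
      (\<Sum>u\<in>pverts G. \<Sum>v\<in>pverts G. adjacency_mat G \<sigma> $$ (\<sigma> u, \<sigma> v) * f (\<sigma> u) (\<sigma> v))"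
    unfolding N sum_vertex_labeling[OF \<sigma>] ..
  also have "\<dots> = (\<Sum>u\<in>pverts G. \<Sum>v\<in>pverts G. if (u, v) \<in> parcs G then f (\<sigma> u) (\<sigma> v) else 0)"
    by (intro sum.cong refl) (auto simp: adjacency_mat_def vertex_labelingD[OF \<sigma>])
  also have "\<dots> = (\<Sum>p\<in>pverts G \<times> pverts G. if p \<in> parcs G then case p of (u, v) \<Rightarrow> f (\<sigma> u) (\<sigma> v) else 0)"
    by (subst sum.cartesian_product) (auto intro!: sum.cong)
  also have "\<dots> = (\<Sum>(u, v)\<in>parcs G. f (\<sigma> u) (\<sigma> v))"
    by (rule sum.mono_neutral_cong_right) (auto dest: in_arcsD1 in_arcsD2)
  finally show ?thesis .
qed

lemma pair_graph_arc_commute: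
  assumes "pair_graph G"
  shows "(u, v) \<in> parcs G \<longleftrightarrow> (v, u) \<in> parcs G"
proof -
  interpret pair_graph G by fact
  show ?thesis
    using pair_sym_arcs by (auto simp: symmetric_conv)
qed

lemma adjacency_mat_commute:
  assumes "pair_graph G" "x < card (pverts G)" "y < card (pverts G)"
  shows "adjacency_mat G \<sigma> $$ (y, x) = adjacency_mat G \<sigma> $$ (x, y)"
proof -
  interpret pair_graph G by fact
  have "(u, v) \<in> parcs G \<longleftrightarrow> (v, u) \<in> parcs G" for u v
    by (rule pair_graph_arc_commute [OF assms(1)])
  thus ?thesis
    using assms by (simp add: adjacency_mat_def)
qed

lemma adjacency_mat_diag:
  assumes "pair_graph G" "x < card (pverts G)"
  shows "adjacency_mat G \<sigma> $$ (x, x) = 0"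
proof -
  interpret pair_graph G by fact
  show ?thesis
    using assms(2) pair_no_loops by (fastforce simp: adjacency_mat_def)
qed

lemma mat_trace_adjacency_mat: "pair_graph G \<Longrightarrow> mat_trace (adjacency_mat G \<sigma>) = 0"
  by (simp add: mat_trace_def adjacency_mat_diag carrier_matD[OF adjacency_mat_carrier])

text \<open>Symmetry and 0-1 entries reduce each product of opposite entries to a single
  entry.\<close>

lemma mat_trace_adjacency_mat_square:
  assumes G: "pair_graph G" and \<sigma>: "vertex_labeling G \<sigma>"
  shows "mat_trace (adjacency_mat G \<sigma> * adjacency_mat G \<sigma>) = of_nat (card (parcs G))"
proof -
  define N where "N = card (pverts G)"
  let ?A = "adjacency_mat G \<sigma>"
  have A: "?A \<in> carrier_mat N N"
    by (simp add: N_def)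
  have "mat_trace (?A * ?A) = (\<Sum>x<N. \<Sum>y<N. ?A $$ (x, y) * ?A $$ (y, x))"
    using A by (simp add: mat_trace_def index_mult_mat_sum[OF A A] del: index_mult_mat(1))
  also have "\<dots> = (\<Sum>x<N. \<Sum>y<N. ?A $$ (x, y) * 1)"
  proof (intro sum.cong refl)
    fix x y assume "x \<in> {..<N}" "y \<in> {..<N}"
    thus "?A $$ (x, y) * ?A $$ (y, x) = ?A $$ (x, y) * 1"
      unfolding N_def by (subst adjacency_mat_commute[OF G]) (auto simp: adjacency_mat_def)
  qed
  also have "\<dots> = of_nat (card (parcs G))"
    unfolding sum_adjacency_mat[OF G \<sigma> N_def] by simp
  finally show ?thesis .
qed

lemma frobenius_norm_adjacency_mat:
  assumes G: "pair_graph G" and \<sigma>: "vertex_labeling G \<sigma>"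
  shows "frobenius_norm (adjacency_mat G \<sigma>) = sqrt (card (parcs G))"
proof -
  define N where "N = card (pverts G)"
  let ?A = "adjacency_mat G \<sigma>"
  \<comment> \<open>An entry 0 or 1 equals its squared modulus.\<close>
  have "complex_of_real (\<Sum>x<N. \<Sum>y<N. (cmod (?A $$ (x, y)))\<^sup>2) = (\<Sum>x<N. \<Sum>y<N. ?A $$ (x, y) * 1)"
    unfolding of_real_sum by (intro sum.cong refl) (auto simp: N_def adjacency_mat_def)
  also have "\<dots> = complex_of_real (card (parcs G))"
    unfolding sum_adjacency_mat[OF G \<sigma> N_def] by simp
  finally have "(\<Sum>x<N. \<Sum>y<N. (cmod (?A $$ (x, y)))\<^sup>2) = card (parcs G)"
    by (simp only: of_real_eq_iff)
  thus ?thesis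
    by (simp add: frobenius_norm_def adjacency_mat_def N_def)
qed

text \<open>Above each edge lie its two orientations, which are distinct since loops are
  excluded.\<close>

lemma card_parcs:
  assumes "pair_graph G"
  shows "card (parcs G) = 2 * num_edges G"
proof -
  interpret pair_graph G by fact
  let ?e = "\<lambda>(u, v). {u, v}"
  have fibre: "card {p \<in> parcs G. ?e p = E} = 2" if "E \<in> ?e ` parcs G" for E
  proof -
    from that obtain u v where uv: "(u, v) \<in> parcs G" and E: "E = {u, v}"
      by auto
    have vu: "(v, u) \<in> parcs G"
      using uv pair_graph_arc_commute[OF assms] by blast
    have "{p \<in> parcs G. ?e p = E} = {(u, v), (v, u)}"
    proof (intro equalityI subsetI)
      fix p assume "p \<in> {p \<in> parcs G. ?e p = E}"
      thus "p \<in> {(u, v), (v, u)}"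
        by (cases p) (simp add: E doubleton_eq_iff)
    qed (use uv vu in \<open>auto simp: E\<close>)
    moreover have "u \<noteq> v"
      using pair_no_loops[OF uv] by simp
    ultimately show ?thesis
      by simp
  qed
  have "card (parcs G) = (\<Sum>E\<in>?e ` parcs G. \<Sum>p | p \<in> parcs G \<and> ?e p = E. 1)"
    unfolding card_eq_sum by (rule sum.image_gen[OF pair_finite_arcs])
  also have "\<dots> = (\<Sum>E\<in>?e ` parcs G. 2)"
    by (intro sum.cong refl) (simp only: fibre flip: card_eq_sum)
  finally show ?thesis
    by (simp add: num_edges_def)
qed

text \<open>The squared adjacency matrix has nonzero trace, twice the number of edges. This permits
  division by the energy.\<close>

lemma energy_pos:
  assumes G: "pair_graph G" and "num_edges G \<ge> 1"
  shows "energy G > 0"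
proof -
  interpret pair_graph G by fact
  obtain \<sigma> where \<sigma>: "vertex_labeling G \<sigma>"
    using ex_vertex_labeling[OF pair_finite_verts] ..
  have "mat_trace (adjacency_mat G \<sigma> * adjacency_mat G \<sigma>) \<noteq> 0"
    using assms by (simp add: mat_trace_adjacency_mat_square[OF G \<sigma>] card_parcs)
  from mat_energy_pos[OF adjacency_mat_carrier this] show ?thesis
    by (simp add: energy_eq[OF \<sigma>])
qed

section \<open>The energy of a Cartesian product\<close>

lemma pverts_cartesian_product [simp]:
  "pverts (cartesian_product G H) = pverts G \<times> pverts H"
  by (simp add: cartesian_product_def)

text \<open>The energy may be computed from any labeling; this one numbers pairs of vertices by the
  quotient-remainder encoding of \<open>kron\<close>.\<close>

lemma cartesian_product_lexicographic_labeling: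
  assumes G: "pair_graph G" and H: "pair_graph H"
    and \<sigma>: "vertex_labeling G \<sigma>" and \<tau>: "vertex_labeling H \<tau>"
  defines "\<rho> \<equiv> \<lambda>(g, h). \<sigma> g * card (pverts H) + \<tau> h"
  shows "vertex_labeling (cartesian_product G H) \<rho>"
    and "adjacency_mat (cartesian_product G H) \<rho> =
      kron_sum (adjacency_mat G \<sigma>) (adjacency_mat H \<tau>)"
proof -
  define n m where "n = card (pverts G)" and "m = card (pverts H)"
  let ?V = "pverts G \<times> pverts H"
  let ?g = "inv_into (pverts G) \<sigma>" and ?h = "inv_into (pverts H) \<tau>"
  note s = vertex_labelingD[OF \<sigma>, folded n_def] and t = vertex_labelingD[OF \<tau>, folded m_def]
  have k: "k div m < n" "k mod m < m" if "k < n * m" for k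
    using that by (cases "m = 0"; auto simp: less_mult_imp_div_less)+
  have \<rho>_less: "\<rho> p < n * m" if "p \<in> ?V" for p
  proof -
    obtain g h where p: "p = (g, h)" "g \<in> pverts G" "h \<in> pverts H"
      using \<open>p \<in> ?V\<close> by auto
    have "\<sigma> g * m + \<tau> h < Suc (\<sigma> g) * m"
      using t(1)[OF p(3)] by simp
    also have "\<dots> \<le> n * m"
      using s(1)[OF p(2)] by (intro mult_right_mono) auto
    finally show ?thesis
      by (simp add: \<rho>_def p(1) m_def)
  qed
  have inv1: "(?g (\<rho> p div m), ?h (\<rho> p mod m)) = p" if "p \<in> ?V" for p
  proof -
    obtain g h where p: "p = (g, h)" "g \<in> pverts G" "h \<in> pverts H"
      using \<open>p \<in> ?V\<close> by auto
    have "\<rho> p div m = \<sigma> g" "\<rho> p mod m = \<tau> h"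
      using t(1)[OF p(3)] by (simp_all add: \<rho>_def p(1) flip: m_def)
    thus ?thesis
      by (simp only: p(1) s(2)[OF p(2)] t(2)[OF p(3)])
  qed
  have inv2: "\<rho> (?g (k div m), ?h (k mod m)) = k" if "k < n * m" for k
    using k[OF that] s t by (simp add: \<rho>_def flip: m_def)
  have bij: "bij_betw \<rho> ?V {0..<n * m}"
  proof (rule bij_betw_byWitness[where f' = "\<lambda>k. (?g (k div m), ?h (k mod m))"])
    show "\<forall>p\<in>?V. (?g (\<rho> p div m), ?h (\<rho> p mod m)) = p"
      using inv1 by blast
    show "\<forall>k\<in>{0..<n * m}. \<rho> (?g (k div m), ?h (k mod m)) = k"
      using inv2 by simp
    show "\<rho> ` ?V \<subseteq> {0..<n * m}"
      using \<rho>_less by auto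
    show "(\<lambda>k. (?g (k div m), ?h (k mod m))) ` {0..<n * m} \<subseteq> ?V"
      using k s(3) t(3) by auto
  qed
  thus lab: "vertex_labeling (cartesian_product G H) \<rho>"
    by (simp add: vertex_labeling_def n_def m_def card_cartesian_product)
  have inv: "inv_into ?V \<rho> k = (?g (k div m), ?h (k mod m))" if "k < n * m" for k
  proof (rule inv_into_f_eq)
    show "inj_on \<rho> ?V"
      using bij by (rule bij_betw_imp_inj_on)
    show "(?g (k div m), ?h (k mod m)) \<in> ?V"
      using k[OF that] s(3) t(3) by simp
  qed (rule inv2[OF that])
  interpret G: pair_graph G by fact
  interpret H: pair_graph H by fact
  have A: "adjacency_mat G \<sigma> \<in> carrier_mat n n" and B: "adjacency_mat H \<tau> \<in> carrier_mat m m"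
    by (simp_all add: n_def m_def)
  show "adjacency_mat (cartesian_product G H) \<rho> =
      kron_sum (adjacency_mat G \<sigma>) (adjacency_mat H \<tau>)" (is "?L = ?R")
  proof (rule eq_matI)
    show dim: "dim_row ?L = dim_row ?R" "dim_col ?L = dim_col ?R"
      using kron_sum_carrier[OF A B] adjacency_mat_carrier[of "cartesian_product G H" \<rho>]
      by (auto simp: n_def m_def card_cartesian_product)
    fix i j assume "i < dim_row ?R" "j < dim_col ?R"
    hence ij: "i < n * m" "j < n * m"
      using kron_sum_carrier[OF A B] by auto
    have eqg: "?g (i div m) = ?g (j div m) \<longleftrightarrow> i div m = j div m"
      using s(4) k ij by metis
    have eqh: "?h (i mod m) = ?h (j mod m) \<longleftrightarrow> i mod m = j mod m"
      using t(4) k ij by metis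
    have loop: "(u, u) \<notin> parcs G" "(v, v) \<notin> parcs H" for u v
      using G.pair_no_loops[of "(u, u)"] H.pair_no_loops[of "(v, v)"] by auto
    define a b c d where "a = ?g (i div m)" and "b = ?g (j div m)"
      and "c = ?h (i mod m)" and "d = ?h (j mod m)"
    have mem: "a \<in> pverts G" "c \<in> pverts H"
      using k[OF ij(1)] s(3) t(3) by (simp_all add: a_def c_def)
    have "?L $$ (i, j) = (if ((a, c), (b, d)) \<in> parcs (cartesian_product G H) then 1 else 0)"
      using ij inv[OF ij(1)] inv[OF ij(2)]
      by (simp add: adjacency_mat_def card_cartesian_product a_def b_def c_def d_def flip: n_def m_def)
    also have "\<dots> = (if a = b \<and> (c, d) \<in> parcs H \<or> c = d \<and> (a, b) \<in> parcs G then 1 else 0)"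
      using mem by (simp add: cartesian_product_def)
    \<comment> \<open>Without loops the two alternatives exclude each other, so the disjunction
      becomes a sum.\<close>
    also have "\<dots> = (if c = d then if (a, b) \<in> parcs G then 1 else 0 else 0) +
        (if a = b then if (c, d) \<in> parcs H then 1 else 0 else 0)"
      using loop by (cases "a = b"; cases "c = d") auto
    also have "\<dots> = (if i mod m = j mod m then adjacency_mat G \<sigma> $$ (i div m, j div m) else 0) +
        (if i div m = j div m then adjacency_mat H \<tau> $$ (i mod m, j mod m) else 0)"
      using k[OF ij(1)] k[OF ij(2)]
      by (simp add: adjacency_mat_def a_def b_def c_def d_def eqg eqh flip: n_def m_def)
    also have "\<dots> = ?R $$ (i, j)"
      by (rule index_kron_sum[OF A B ij, symmetric])
    finally show "?L $$ (i, j) = ?R $$ (i, j)" .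
  qed
qed

lemma energy_cartesian_product_ge:
  assumes G: "pair_graph G" and H: "pair_graph H"
  shows "energy (cartesian_product G H) \<ge> real (card (pverts H)) * energy G"
    and "energy (cartesian_product G H) \<ge> real (card (pverts G)) * energy H"
proof -
  interpret G: pair_graph G by fact
  interpret H: pair_graph H by fact
  obtain \<sigma> where \<sigma>: "vertex_labeling G \<sigma>"
    using ex_vertex_labeling[OF G.pair_finite_verts] ..
  obtain \<tau> where \<tau>: "vertex_labeling H \<tau>"
    using ex_vertex_labeling[OF H.pair_finite_verts] ..
  note lex = cartesian_product_lexicographic_labeling[OF G H \<sigma> \<tau>]
  note ge = mat_energy_kron_sum_ge[OF adjacency_mat_carrier adjacency_mat_carrier
      mat_trace_adjacency_mat[OF G] mat_trace_adjacency_mat[OF H]]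
  show "energy (cartesian_product G H) \<ge> real (card (pverts H)) * energy G"
    and "energy (cartesian_product G H) \<ge> real (card (pverts G)) * energy H"
    unfolding energy_eq[OF lex(1)] energy_eq[OF \<sigma>] energy_eq[OF \<tau>] lex(2) by (rule ge)+
qed

section \<open>The Fourier ratio of an adjacency matrix\<close>

text \<open>The entry of F A F at \<open>(m, n)\<close>, multiplied by the order. All natural
  indices are allowed, so that the sum for a factor can be evaluated at indices of the
  product.\<close>

definition arc_sum :: "'a pair_pre_digraph \<Rightarrow> ('a \<Rightarrow> nat) \<Rightarrow> nat \<Rightarrow> nat \<Rightarrow> complex" where
  "arc_sum G \<sigma> m n = (\<Sum>(u, v)\<in>parcs G.
     fourier_char (card (pverts G)) (int m * int (\<sigma> u) + int n * int (\<sigma> v)))"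

text \<open>The entrywise norm of F A F, the only part of the Fourier ratio that depends on the
  labeling.\<close>

definition fourier_l1 :: "'a pair_pre_digraph \<Rightarrow> ('a \<Rightarrow> nat) \<Rightarrow> real" where
  "fourier_l1 G \<sigma> = (\<Sum>m<card (pverts G). \<Sum>n<card (pverts G). cmod (arc_sum G \<sigma> m n)) /
     card (pverts G)"

lemma num_edges_pos_imp_arc:
  assumes "num_edges G \<ge> 1"
  obtains u v where "(u, v) \<in> parcs G"
proof -
  have "parcs G \<noteq> {}"
    using assms by (auto simp: num_edges_def)
  with that show ?thesis
    by auto
qed

lemma card_pverts_pos:
  assumes "pair_graph G" "num_edges G \<ge> 1"
  shows "card (pverts G) > 0"
proof -
  interpret pair_graph G by fact
  obtain u v where "(u, v) \<in> parcs G"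
    using num_edges_pos_imp_arc[OF assms(2)] .
  thus ?thesis
    using pair_finite_verts by (auto simp: card_gt_0_iff dest: in_arcsD1)
qed

lemma index_fourier_adjacency_mat:
  assumes G: "pair_graph G" and \<sigma>: "vertex_labeling G \<sigma>" and N: "N = card (pverts G)"
    and m: "m < N" and n: "n < N"
  shows "(fourier_mat N * adjacency_mat G \<sigma> * fourier_mat N) $$ (m, n) = arc_sum G \<sigma> m n / of_nat N"
proof -
  let ?F = "fourier_mat N" and ?A = "adjacency_mat G \<sigma>"
  have A: "?A \<in> carrier_mat N N"
    by (simp add: N)
  have AF: "?A * ?F \<in> carrier_mat N N"
    using A by simp
  have "(?F * ?A * ?F) $$ (m, n) = (?F * (?A * ?F)) $$ (m, n)"
    by (simp only: assoc_mult_mat[OF fourier_mat_carrier A fourier_mat_carrier])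
  also have "\<dots> = (\<Sum>x<N. ?F $$ (m, x) * (?A * ?F) $$ (x, n))"
    by (rule index_mult_mat_sum[OF fourier_mat_carrier AF m n])
  also have "\<dots> = (\<Sum>x<N. \<Sum>y<N. ?A $$ (x, y) * (?F $$ (m, x) * ?F $$ (y, n)))"
  proof (rule sum.cong[OF refl])
    fix x assume "x \<in> {..<N}"
    hence x: "x < N"
      by simp
    show "?F $$ (m, x) * (?A * ?F) $$ (x, n) =
        (\<Sum>y<N. ?A $$ (x, y) * (?F $$ (m, x) * ?F $$ (y, n)))"
      unfolding index_mult_mat_sum[OF A fourier_mat_carrier x n] sum_distrib_left
      by (simp only: ac_simps)
  qed
  also have "\<dots> = (\<Sum>(u, v)\<in>parcs G. ?F $$ (m, \<sigma> u) * ?F $$ (\<sigma> v, n))"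
    by (rule sum_adjacency_mat[OF G \<sigma> N])
  also have "\<dots> = (\<Sum>(u, v)\<in>parcs G. fourier_char N (int m * int (\<sigma> u) + int n * int (\<sigma> v)) / of_nat N)"
  proof (intro sum.cong refl, clarify)
    fix u v assume "(u, v) \<in> parcs G"
    interpret pair_graph G by fact
    have "\<sigma> u < N" "\<sigma> v < N"
      using \<open>(u, v) \<in> parcs G\<close> vertex_labelingD(1)[OF \<sigma>] by (auto simp: N dest: in_arcsD1 in_arcsD2)
    hence "?F $$ (m, \<sigma> u) * ?F $$ (\<sigma> v, n) =
        fourier_char N (int m * int (\<sigma> u)) * fourier_char N (int n * int (\<sigma> v)) /
        (of_real (sqrt N) * of_real (sqrt N))"
      using m n by (simp add: index_fourier_mat mult.commute[of "int (\<sigma> v)"])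
    also have "complex_of_real (sqrt N) * of_real (sqrt N) = of_nat N"
      by (simp flip: of_real_mult)
    finally show "?F $$ (m, \<sigma> u) * ?F $$ (\<sigma> v, n) =
        fourier_char N (int m * int (\<sigma> u) + int n * int (\<sigma> v)) / of_nat N"
      by (simp add: fourier_char_add)
  qed
  finally show ?thesis
    by (simp add: arc_sum_def N sum_divide_distrib case_prod_unfold)
qed

text \<open>By Parseval the denominator is the Frobenius norm of the adjacency matrix, the square
  root of the number of arcs for every labeling.\<close>

lemma fourier_ratio_adjacency_mat:
  assumes G: "pair_graph G" and \<sigma>: "vertex_labeling G \<sigma>" and pos: "card (pverts G) > 0"
  shows "fourier_ratio (adjacency_mat G \<sigma>) = fourier_l1 G \<sigma> / sqrt (2 * real (num_edges G))"
proof -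
  define N where "N = card (pverts G)"
  let ?F = "fourier_mat N" and ?A = "adjacency_mat G \<sigma>"
  have A: "?A \<in> carrier_mat N N"
    by (simp add: N_def)
  have "entrywise_l1_norm (?F * ?A * ?F) = (\<Sum>m<N. \<Sum>n<N. cmod ((?F * ?A * ?F) $$ (m, n)))"
    by (simp add: entrywise_l1_norm_def fourier_mat_def)
  also have "\<dots> = fourier_l1 G \<sigma>"
    by (simp add: index_fourier_adjacency_mat[OF G \<sigma> N_def] norm_divide fourier_l1_def
        sum_divide_distrib flip: N_def)
  finally have "entrywise_l1_norm (?F * ?A * ?F) = fourier_l1 G \<sigma>" .
  moreover have "frobenius_norm (?F * ?A * ?F) = sqrt (2 * real (num_edges G))"
    using frobenius_norm_fourier[OF pos adjacency_mat_carrier, of \<sigma>]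
    by (simp add: frobenius_norm_adjacency_mat[OF G \<sigma>] card_parcs[OF G] N_def)
  moreover have "dim_row ?A = N"
    using A by simp
  ultimately show ?thesis
    by (simp add: fourier_ratio_def)
qed

text \<open>The square root of twice the number of edges cancels between the Fourier ratio and the
  normalised energy. The bound from an arbitrary labeling is applied to the product graph.\<close>

lemma energy_gap_factor_le:
  assumes G: "pair_graph G" and e: "num_edges G \<ge> 1" and \<sigma>: "vertex_labeling G \<sigma>"
  shows "energy_gap_factor G \<le> fourier_l1 G \<sigma> / energy G"
proof -
  have "edge_complexity G \<le> fourier_ratio (adjacency_mat G \<sigma>)"
    unfolding edge_complexity_def using \<sigma> by (intro Min_le finite_fourier_ratios) auto
  also have "\<dots> = fourier_l1 G \<sigma> / sqrt (2 * real (num_edges G))"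
    by (rule fourier_ratio_adjacency_mat[OF G \<sigma> card_pverts_pos[OF G e]])
  finally show ?thesis
    using e energy_pos[OF G e] by (simp add: energy_gap_factor_def field_simps)
qed

text \<open>A minimum over a finite nonempty set is attained. The optimal labelings of both factors
  are the input of \<open>crt_labeling\<close>.\<close>

lemma energy_gap_factor_attained:
  assumes G: "pair_graph G" and e: "num_edges G \<ge> 1"
  obtains \<sigma> where "vertex_labeling G \<sigma>" "energy_gap_factor G = fourier_l1 G \<sigma> / energy G"
proof -
  interpret pair_graph G by fact
  have "edge_complexity G \<in> {fourier_ratio (adjacency_mat G \<sigma>) | \<sigma>. vertex_labeling G \<sigma>}"
    unfolding edge_complexity_def
    by (rule Min_in[OF finite_fourier_ratios fourier_ratios_nonempty[OF pair_finite_verts]])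
  then obtain \<sigma> where \<sigma>: "vertex_labeling G \<sigma>"
    and "edge_complexity G = fourier_ratio (adjacency_mat G \<sigma>)"
    by auto
  hence "energy_gap_factor G = fourier_l1 G \<sigma> / energy G"
    using e by (simp add: energy_gap_factor_def
        fourier_ratio_adjacency_mat[OF G \<sigma> card_pverts_pos[OF G e]])
  with \<sigma> show ?thesis
    by (rule that)
qed

section \<open>The Chinese remainder labeling\<close>

text \<open>The characters are periodic, so indices modulo the order of the product reduce to those
  of a factor.\<close>

lemma arc_sum_mod:
  assumes "card (pverts G) > 0"
  shows "arc_sum G \<sigma> (m mod card (pverts G)) (n mod card (pverts G)) = arc_sum G \<sigma> m n"
  unfolding arc_sum_def
proof (intro sum.cong refl, clarify)
  fix u v
  have "[int (m mod card (pverts G)) * int (\<sigma> u) + int (n mod card (pverts G)) * int (\<sigma> v) =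
      int m * int (\<sigma> u) + int n * int (\<sigma> v)] (mod int (card (pverts G)))"
    by (intro cong_add cong_mult) (auto simp: cong_def zmod_int)
  thus "fourier_char (card (pverts G))
      (int (m mod card (pverts G)) * int (\<sigma> u) + int (n mod card (pverts G)) * int (\<sigma> v)) =
    fourier_char (card (pverts G)) (int m * int (\<sigma> u) + int n * int (\<sigma> v))"
    by (rule fourier_char_cong[OF assms])
qed

text \<open>
  With the labels of the factors mapped into \<open>\<int>\<close> modulo \<open>N\<^sub>1 N\<^sub>2\<close> by \<open>(x, y) \<mapsto> N\<^sub>2 x + N\<^sub>1 y\<close>, the
  characters of \<open>\<int>\<close> modulo \<open>N\<^sub>1 N\<^sub>2\<close> are products of characters of the factors.
\<close>

definition crt_labeling ::
    "'a pair_pre_digraph \<Rightarrow> 'b pair_pre_digraph \<Rightarrow> ('a \<Rightarrow> nat) \<Rightarrow> ('b \<Rightarrow> nat) \<Rightarrow> 'a \<times> 'b \<Rightarrow> nat" where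
  "crt_labeling G H \<sigma> \<tau> =
     (\<lambda>(g, h). (card (pverts H) * \<sigma> g + card (pverts G) * \<tau> h) mod (card (pverts G) * card (pverts H)))"

text \<open>Modulo the order of \<open>G\<close> the term with \<open>\<tau>\<close> vanishes and
  the order of \<open>H\<close> is invertible, so the label determines \<open>\<sigma> g\<close>;
  symmetrically for \<open>\<tau> h\<close>. Equal cardinalities turn injectivity into
  bijectivity.\<close>

lemma vertex_labeling_crt:
  assumes G: "pair_graph G" and H: "pair_graph H"
    and \<sigma>: "vertex_labeling G \<sigma>" and \<tau>: "vertex_labeling H \<tau>"
    and co: "coprime (card (pverts G)) (card (pverts H))"
    and pos: "card (pverts G) > 0" "card (pverts H) > 0"
  shows "vertex_labeling (cartesian_product G H) (crt_labeling G H \<sigma> \<tau>)"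
proof -
  define N1 N2 where "N1 = card (pverts G)" and "N2 = card (pverts H)"
  let ?V = "pverts G \<times> pverts H" and ?\<rho> = "crt_labeling G H \<sigma> \<tau>"
  note co = co[folded N1_def N2_def]
  have inj: "inj_on ?\<rho> ?V"
  proof (rule inj_onI, clarify)
    fix g h g' h'
    assume V: "g \<in> pverts G" "g' \<in> pverts G" "h \<in> pverts H" "h' \<in> pverts H"
      and "?\<rho> (g, h) = ?\<rho> (g', h')"
    hence eq: "[N2 * \<sigma> g + N1 * \<tau> h = N2 * \<sigma> g' + N1 * \<tau> h'] (mod N1 * N2)"
      by (simp add: crt_labeling_def cong_def N1_def N2_def)
    have "[N2 * \<sigma> g = N2 * \<sigma> g'] (mod N1)"
      using cong_dvd_modulus_nat[OF eq, of N1] by (simp add: cong_def)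
    hence "[\<sigma> g = \<sigma> g'] (mod N1)"
      using co by (simp add: cong_mult_lcancel_nat coprime_commute)
    hence "\<sigma> g = \<sigma> g'"
      using V vertex_labelingD(1)[OF \<sigma>] by (simp add: cong_less_modulus_unique_nat N1_def)
    hence 1: "g = g'"
      using V vertex_labelingD(2)[OF \<sigma>] by metis
    have "[N1 * \<tau> h = N1 * \<tau> h'] (mod N2)"
      using cong_dvd_modulus_nat[OF eq, of N2] by (simp add: cong_def)
    hence "[\<tau> h = \<tau> h'] (mod N2)"
      using co by (simp add: cong_mult_lcancel_nat)
    hence "\<tau> h = \<tau> h'"
      using V vertex_labelingD(1)[OF \<tau>] by (simp add: cong_less_modulus_unique_nat N2_def)
    hence 2: "h = h'"
      using V vertex_labelingD(2)[OF \<tau>] by metis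
    from 1 2 show "g = g' \<and> h = h'" ..
  qed
  have "?\<rho> ` ?V = {0..<N1 * N2}"
  proof (rule card_subset_eq)
    show "?\<rho> ` ?V \<subseteq> {0..<N1 * N2}"
      using pos by (auto simp: crt_labeling_def N1_def N2_def)
    show "card (?\<rho> ` ?V) = card {0..<N1 * N2}"
      by (simp add: card_image[OF inj] card_cartesian_product N1_def N2_def)
  qed simp
  with inj show ?thesis
    by (simp add: vertex_labeling_def bij_betw_def card_cartesian_product N1_def N2_def)
qed

text \<open>Dividing \<open>N2 * a + N1 * b\<close> by \<open>N1 * N2\<close> gives
  \<open>a / N1 + b / N2\<close>, so the exponential splits; the reduction modulo
  \<open>N1 * N2\<close> inside the label is invisible to the character.\<close>

lemma fourier_char_crt_labeling:
  assumes "card (pverts G) > 0" "card (pverts H) > 0"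
  shows "fourier_char (card (pverts G) * card (pverts H))
      (int m * int (crt_labeling G H \<sigma> \<tau> (g, h)) + int n * int (crt_labeling G H \<sigma> \<tau> (g', h'))) =
    fourier_char (card (pverts G)) (int m * int (\<sigma> g) + int n * int (\<sigma> g')) *
    fourier_char (card (pverts H)) (int m * int (\<tau> h) + int n * int (\<tau> h'))"
proof -
  define N1 N2 where "N1 = card (pverts G)" and "N2 = card (pverts H)"
  have pos: "N1 > 0" "N2 > 0"
    using assms by (simp_all add: N1_def N2_def)
  let ?a = "int m * int (\<sigma> g) + int n * int (\<sigma> g')"
  let ?b = "int m * int (\<tau> h) + int n * int (\<tau> h')"
  have "[int (crt_labeling G H \<sigma> \<tau> (x, y)) = int N2 * int (\<sigma> x) + int N1 * int (\<tau> y)] (mod int (N1 * N2))"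
    for x y
    by (simp add: crt_labeling_def cong_def zmod_int N1_def N2_def)
  hence "[int m * int (crt_labeling G H \<sigma> \<tau> (g, h)) + int n * int (crt_labeling G H \<sigma> \<tau> (g', h')) =
      int m * (int N2 * int (\<sigma> g) + int N1 * int (\<tau> h)) +
      int n * (int N2 * int (\<sigma> g') + int N1 * int (\<tau> h'))] (mod int (N1 * N2))"
    by (intro cong_add cong_mult cong_refl)
  also have "int m * (int N2 * int (\<sigma> g) + int N1 * int (\<tau> h)) +
      int n * (int N2 * int (\<sigma> g') + int N1 * int (\<tau> h')) = int N2 * ?a + int N1 * ?b"
    by (simp add: algebra_simps)
  finally have "fourier_char (N1 * N2)
      (int m * int (crt_labeling G H \<sigma> \<tau> (g, h)) + int n * int (crt_labeling G H \<sigma> \<tau> (g', h'))) =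
    fourier_char (N1 * N2) (int N2 * ?a + int N1 * ?b)"
    using pos by (intro fourier_char_cong) auto
  also have "\<dots> = fourier_char N1 ?a * fourier_char N2 ?b"
    unfolding fourier_char_add[of _ "int N2 * ?a"] fourier_char_cancel[OF pos(2), of N1]
    by (simp only: mult.commute[of N1 N2] fourier_char_cancel[OF pos(1), of N2])
  finally show ?thesis
    by (simp only: N1_def N2_def)
qed

text \<open>The arcs form copies of \<open>H\<close> over the vertices of \<open>G\<close> and
  copies of \<open>G\<close> over the vertices of \<open>H\<close>. An arc in both families would
  project to a loop of \<open>G\<close>.\<close>

lemma sum_parcs_cartesian_product:
  assumes G: "pair_graph G" and H: "pair_graph H"
  shows "(\<Sum>((g, h), (g', h'))\<in>parcs (cartesian_product G H). f g h g' h') =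
    (\<Sum>g\<in>pverts G. \<Sum>(h, h')\<in>parcs H. f g h g h') +
    (\<Sum>h\<in>pverts H. \<Sum>(g, g')\<in>parcs G. f g h g' h)"
proof -
  interpret G: pair_graph G by fact
  interpret H: pair_graph H by fact
  let ?i = "\<lambda>(g, h, h'). ((g, h), (g, h'))" and ?j = "\<lambda>(h, g, g'). ((g, h), (g', h))"
  let ?f = "\<lambda>((g, h), (g', h')). f g h g' h'"
  have eq: "parcs (cartesian_product G H) = ?i ` (pverts G \<times> parcs H) \<union> ?j ` (pverts H \<times> parcs G)"
    by (auto simp: cartesian_product_def image_iff Bex_def)
  have "sum ?f (parcs (cartesian_product G H)) =
      sum ?f (?i ` (pverts G \<times> parcs H)) + sum ?f (?j ` (pverts H \<times> parcs G))"
    unfolding eq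
  proof (rule sum.union_disjoint)
    show "?i ` (pverts G \<times> parcs H) \<inter> ?j ` (pverts H \<times> parcs G) = {}"
      using G.pair_no_loops by fastforce
  qed (use G.pair_finite_verts H.pair_finite_verts G.pair_finite_arcs H.pair_finite_arcs in auto)
  also have "sum ?f (?i ` (pverts G \<times> parcs H)) = (\<Sum>g\<in>pverts G. \<Sum>(h, h')\<in>parcs H. f g h g h')"
    by (subst sum.reindex) (auto intro!: inj_onI sum.cong simp: sum.cartesian_product)
  also have "sum ?f (?j ` (pverts H \<times> parcs G)) = (\<Sum>h\<in>pverts H. \<Sum>(g, g')\<in>parcs G. f g h g' h)"
    by (subst sum.reindex) (auto intro!: inj_onI sum.cong simp: sum.cartesian_product)
  finally show ?thesis .
qed

text \<open>The order times the entry of the squared Fourier matrix at \<open>(m, n)\<close>,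
  evaluated by orthogonality of characters.\<close>

lemma sum_vertices_fourier_char:
  assumes "vertex_labeling G \<sigma>" "card (pverts G) > 0"
  shows "(\<Sum>u\<in>pverts G. fourier_char (card (pverts G)) (int m * int (\<sigma> u) + int n * int (\<sigma> u))) =
    of_nat (card (pverts G)) * of_bool (card (pverts G) dvd m + n)"
proof -
  have "(\<Sum>u\<in>pverts G. fourier_char (card (pverts G)) (int m * int (\<sigma> u) + int n * int (\<sigma> u))) =
      (\<Sum>x<card (pverts G). fourier_char (card (pverts G)) (int (m + n) * int x))"
    unfolding sum_vertex_labeling[OF assms(1)] by (simp add: algebra_simps)
  also have "\<dots> = of_nat (card (pverts G)) * of_bool (card (pverts G) dvd m + n)"
    unfolding sum_fourier_char[OF assms(2)] int_dvd_int_iff by simp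
  finally show ?thesis .
qed

text \<open>The entrywise form of the Kronecker decomposition of F A F. On a copy of
  \<open>H\<close> the vertex of \<open>G\<close> is constant, so its character sum separates off;
  likewise with the factors exchanged.\<close>

lemma arc_sum_crt_labeling:
  assumes G: "pair_graph G" and H: "pair_graph H"
    and \<sigma>: "vertex_labeling G \<sigma>" and \<tau>: "vertex_labeling H \<tau>"
    and pos: "card (pverts G) > 0" "card (pverts H) > 0"
  shows "arc_sum (cartesian_product G H) (crt_labeling G H \<sigma> \<tau>) m n =
    of_nat (card (pverts G)) * of_bool (card (pverts G) dvd m + n) * arc_sum H \<tau> m n +
    of_nat (card (pverts H)) * of_bool (card (pverts H) dvd m + n) * arc_sum G \<sigma> m n"
proof -
  let ?\<rho> = "crt_labeling G H \<sigma> \<tau>"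
  let ?a = "\<lambda>g g'. fourier_char (card (pverts G)) (int m * int (\<sigma> g) + int n * int (\<sigma> g'))"
  let ?b = "\<lambda>h h'. fourier_char (card (pverts H)) (int m * int (\<tau> h) + int n * int (\<tau> h'))"
  have "arc_sum (cartesian_product G H) ?\<rho> m n =
      (\<Sum>((g, h), (g', h'))\<in>parcs (cartesian_product G H). ?a g g' * ?b h h')"
    unfolding arc_sum_def
    by (intro sum.cong refl)
      (auto simp: card_cartesian_product fourier_char_crt_labeling[OF pos])
  also have "\<dots> = (\<Sum>g\<in>pverts G. \<Sum>(h, h')\<in>parcs H. ?a g g * ?b h h') +
      (\<Sum>h\<in>pverts H. \<Sum>(g, g')\<in>parcs G. ?a g g' * ?b h h)"
    by (rule sum_parcs_cartesian_product[OF G H])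
  also have "(\<Sum>g\<in>pverts G. \<Sum>(h, h')\<in>parcs H. ?a g g * ?b h h') =
      (\<Sum>g\<in>pverts G. ?a g g) * arc_sum H \<tau> m n"
    by (simp add: arc_sum_def sum_product case_prod_unfold)
  also have "(\<Sum>h\<in>pverts H. \<Sum>(g, g')\<in>parcs G. ?a g g' * ?b h h) =
      (\<Sum>h\<in>pverts H. ?b h h) * arc_sum G \<sigma> m n"
    by (simp add: arc_sum_def sum_product case_prod_unfold mult.commute)
  finally show ?thesis
    by (simp only: sum_vertices_fourier_char[OF \<sigma> pos(1)] sum_vertices_fourier_char[OF \<tau> pos(2)])
qed

lemma fourier_l1_crt_labeling_le:
  assumes G: "pair_graph G" and H: "pair_graph H"
    and \<sigma>: "vertex_labeling G \<sigma>" and \<tau>: "vertex_labeling H \<tau>"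
    and co: "coprime (card (pverts G)) (card (pverts H))"
    and pos: "card (pverts G) > 0" "card (pverts H) > 0"
  shows "fourier_l1 (cartesian_product G H) (crt_labeling G H \<sigma> \<tau>) \<le>
    card (pverts H) * fourier_l1 G \<sigma> + card (pverts G) * fourier_l1 H \<tau>"
proof -
  define N1 N2 where "N1 = card (pverts G)" and "N2 = card (pverts H)"
  have N: "N1 > 0" "N2 > 0" "coprime N1 N2" "coprime N2 N1"
    using pos co by (simp_all add: N1_def N2_def coprime_commute)
  let ?S = "\<lambda>m n. cmod (arc_sum G \<sigma> m n)" and ?T = "\<lambda>m n. cmod (arc_sum H \<tau> m n)"
  let ?R = "\<lambda>m n. cmod (arc_sum (cartesian_product G H) (crt_labeling G H \<sigma> \<tau>) m n)"
  \<comment> \<open>The triangle inequality, with the indices of each factor reduced by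
    periodicity.\<close>
  have "?R m n \<le> real N1 * (of_bool (N1 dvd m + n) * ?T (m mod N2) (n mod N2)) +
      real N2 * (of_bool (N2 dvd m + n) * ?S (m mod N1) (n mod N1))" for m n
    unfolding arc_sum_crt_labeling[OF G H \<sigma> \<tau> pos] N1_def N2_def
      arc_sum_mod[OF pos(1)] arc_sum_mod[OF pos(2)]
    by (rule norm_triangle_le) (simp add: norm_mult)
  hence "(\<Sum>m<N1 * N2. \<Sum>n<N1 * N2. ?R m n) \<le> (\<Sum>m<N1 * N2. \<Sum>n<N1 * N2.
      real N1 * (of_bool (N1 dvd m + n) * ?T (m mod N2) (n mod N2)) +
      real N2 * (of_bool (N2 dvd m + n) * ?S (m mod N1) (n mod N1)))"
    by (intro sum_mono)
  \<comment> \<open>The bounds of the second sum are written as \<open>N2 * N1\<close>, so that the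
    counting lemma applies with the factors exchanged.\<close>
  also have "\<dots> =
      real N1 * (\<Sum>m<N1 * N2. \<Sum>n<N1 * N2. of_bool (N1 dvd m + n) * ?T (m mod N2) (n mod N2)) +
      real N2 * (\<Sum>m<N2 * N1. \<Sum>n<N2 * N1. of_bool (N2 dvd m + n) * ?S (m mod N1) (n mod N1))"
    unfolding sum_distrib_left sum.distrib mult.commute[of N2 N1] ..
  \<comment> \<open>One \<open>N1\<close> is the prefactor, the other counts the pairs of residues
    modulo \<open>N1\<close> with sum zero; likewise for \<open>N2\<close>.\<close>
  also have "\<dots> = real N1 * (real N1 * (\<Sum>b<N2. \<Sum>d<N2. ?T b d)) +
      real N2 * (real N2 * (\<Sum>a<N1. \<Sum>c<N1. ?S a c))"
    by (simp only: sum_of_bool_dvd_add_mod[OF N(3), of ?T] sum_of_bool_dvd_add_mod[OF N(4), of ?S])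
  finally have "(\<Sum>m<N1 * N2. \<Sum>n<N1 * N2. ?R m n) / (N1 * N2) \<le>
      N2 * ((\<Sum>a<N1. \<Sum>c<N1. ?S a c) / N1) + N1 * ((\<Sum>b<N2. \<Sum>d<N2. ?T b d) / N2)"
    using N by (simp add: field_simps)
  thus ?thesis
    by (simp add: fourier_l1_def card_cartesian_product N1_def N2_def)
qed

section \<open>Comparison of the energy-gap factors\<close>

lemma num_edges_cartesian_product_pos:
  assumes "pair_graph G" "pair_graph H" "num_edges G \<ge> 1" "num_edges H \<ge> 1"
  shows "num_edges (cartesian_product G H) \<ge> 1"
proof -
  interpret P: pair_graph "cartesian_product G H"
    using assms by (intro pair_graph_cartesian_product)
  obtain g where "g \<in> pverts G"
    using card_pverts_pos[OF assms(1,3)] by (fastforce simp: card_gt_0_iff)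
  moreover obtain h h' where "(h, h') \<in> parcs H"
    using num_edges_pos_imp_arc[OF assms(4)] .
  ultimately have "((g, h), (g, h')) \<in> parcs (cartesian_product G H)"
    by (auto simp: cartesian_product_def)
  hence "card (parcs (cartesian_product G H)) > 0"
    using P.pair_finite_arcs by (auto simp: card_gt_0_iff)
  thus ?thesis
    using card_parcs[OF P.pair_graph_axioms] by linarith
qed

theorem proposition3p8:
  fixes G :: "'a pair_pre_digraph" and H :: "'b pair_pre_digraph" and N1 N2 :: nat
  assumes "pair_graph G" and "pair_graph H"
    and "card (pverts G) = N1" and "card (pverts H) = N2"
    and "num_edges G \<ge> 1" and "num_edges H \<ge> 1"
  shows "energy (cartesian_product G H) \<ge> 1 / 2 * (real N2 * energy G + real N1 * energy H) \<and>
    (coprime N1 N2 \<longrightarrow>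
      energy_gap_factor (cartesian_product G H)
        \<le> 2 * max (energy_gap_factor G) (energy_gap_factor H))"
proof (intro conjI impI)
  note G = assms(1) and H = assms(2) and N = assms(3,4)
  note eG = assms(5) and eH = assms(6)
  let ?P = "cartesian_product G H"
  show E: "energy ?P \<ge> 1 / 2 * (real N2 * energy G + real N1 * energy H)"
    using energy_cartesian_product_ge[OF G H] by (simp add: N)
  assume co: "coprime N1 N2"
  note P = pair_graph_cartesian_product[OF G H] and eP = num_edges_cartesian_product_pos[OF G H eG eH]
  note pos = card_pverts_pos[OF G eG] card_pverts_pos[OF H eH]
  have co': "coprime (card (pverts G)) (card (pverts H))"
    using co by (simp add: N)
  obtain \<sigma> where \<sigma>: "vertex_labeling G \<sigma>" "energy_gap_factor G = fourier_l1 G \<sigma> / energy G"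
    using energy_gap_factor_attained[OF G eG] .
  obtain \<tau> where \<tau>: "vertex_labeling H \<tau>" "energy_gap_factor H = fourier_l1 H \<tau> / energy H"
    using energy_gap_factor_attained[OF H eH] .
  define K where "K = max (energy_gap_factor G) (energy_gap_factor H)"
  \<comment> \<open>At the optimal labelings, \<open>fourier_l1\<close> equals the energy-gap factor
    times the energy.\<close>
  have l1: "fourier_l1 G \<sigma> \<le> K * energy G" "fourier_l1 H \<tau> \<le> K * energy H"
    using energy_pos[OF G eG] energy_pos[OF H eH]
    by (simp_all add: K_def \<sigma>(2) \<tau>(2) flip: pos_divide_le_eq)
  \<comment> \<open>This yields \<open>K \<ge> 0\<close>, so that the energy bound may be multiplied
    by \<open>2 * K\<close>.\<close>
  have "0 \<le> fourier_l1 G \<sigma>"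
    by (simp add: fourier_l1_def sum_nonneg)
  hence K: "K \<ge> 0"
    using energy_pos[OF G eG] by (simp add: K_def \<sigma>(2) le_max_iff_disj)
  have "fourier_l1 ?P (crt_labeling G H \<sigma> \<tau>) \<le> N2 * fourier_l1 G \<sigma> + N1 * fourier_l1 H \<tau>"
    using fourier_l1_crt_labeling_le[OF G H \<sigma>(1) \<tau>(1) co' pos] by (simp add: N)
  also have "\<dots> \<le> N2 * (K * energy G) + N1 * (K * energy H)"
    using l1 by (intro add_mono mult_left_mono) auto
  \<comment> \<open>The factor 2 compensates the one half in the energy bound.\<close>
  also have "\<dots> = 2 * K * (1 / 2 * (real N2 * energy G + real N1 * energy H))"
    by (simp add: algebra_simps)
  also have "\<dots> \<le> 2 * K * energy ?P"
    using E K by (intro mult_left_mono) auto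
  finally have "fourier_l1 ?P (crt_labeling G H \<sigma> \<tau>) / energy ?P \<le> 2 * K"
    using energy_pos[OF P eP] by (simp add: pos_divide_le_eq)
  with energy_gap_factor_le[OF P eP vertex_labeling_crt[OF G H \<sigma>(1) \<tau>(1) co' pos]]
  show "energy_gap_factor ?P \<le> 2 * max (energy_gap_factor G) (energy_gap_factor H)"
    unfolding K_def by linarith
qed

end
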